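(* Assume $\mathrm{GCH}$. Let $\kappa$ be an infinite regular cardinal and $X$ a graph. If $\mathsf{SList}(X,\kappa)$ holds, then (1) $\mathsf{Col}(X,\kappa^{++})$ holds; and (2) if moreover $\lambda\in I[\lambda]$ for all regular cardinals $\lambda$, then $\mathsf{Col}(X,\kappa^{+})$ holds.
   Context: A graph is $X=(V_X,E_X)$ with $E_X\subseteq [V_X]^2$. A function $c$ with domain $V_X$ is good if $c(v)\neq c(w)$ whenever $\{v,w\}\in E_X$. For regular $\kappa$, $\mathsf{stat}_\kappa$ is the set of stationary subsets of $\kappa$, and $\mathsf{SList}(X,\kappa)$ means: for every $L:V_X\to\mathsf{stat}_\kappa$ there is a good $c$ with $c(v)\in L(v)$ for all $v$. $\mathsf{Col}(X,\mu)$ means there is a well-order $\prec$ of $V_X$ such that for every $v\in V_X$ the set $\{w\in V_X: w\prec v,\ \{v,w\}\in E_X\}$ has size $<\mu$. For a regular cardinal $\lambda$, $I[\lambda]$ is the set of all $S\subseteq\lambda$ for which there are a sequence $\langle b_\xi:\xi<\lambda\rangle$ of bounded subsets of $\lambda$ and a club $C\subseteq\lambda$ such that for every $\gamma\in C\cap S$ there is a cofinal $c_\gamma\subseteq\gamma$ of order type $\mathrm{cf}(\gamma)$ such that for every $\delta<\gamma$ there is $\eta<\gamma$ with $c_\gamma\cap\delta=b_\eta$.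
   Formalization: For κ = ω, "stationary subset of κ" is read as "unbounded subset of ω", because with "meets every club" (i.e. cofinite) the claim fails for the complete bipartite graph K_{ω₂,ω₃}; for uncountable κ the usual definition is used. *)

theory Defs
  imports Main "HOL-Library.Ramsey"
begin

unbundle cardinal_syntax

text \<open>
  All vertex sets and all ordinals below live in one arbitrary type \<open>'u\<close>. A cardinal is a
  relation \<open>k :: 'u rel\<close> with \<open>Card_order k\<close>; its ordinals are the elements of \<open>Field k\<close>, and an
  ordinal \<open>\<gamma>\<close>, as a set of smaller ordinals, is \<open>underS k \<gamma>\<close>.
\<close>

definition regular_cardinal :: "'u rel \<Rightarrow> bool" where
  "regular_cardinal k \<longleftrightarrow> Cinfinite k \<and> regularCard k"

text \<open>GCH for the cardinals represented on \<open>'u\<close>; HOL cannot quantify over all types in a formula.\<close>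

definition GCH :: "'u itself \<Rightarrow> bool" where
  "GCH _ \<longleftrightarrow> (\<forall>A :: 'u set. infinite A \<longrightarrow> |Pow A| =o cardSuc |A| )"

definition unbounded_in :: "'u rel \<Rightarrow> 'u set \<Rightarrow> bool" where
  "unbounded_in k A \<longleftrightarrow> A \<subseteq> Field k \<and> (\<forall>\<alpha>\<in>Field k. \<exists>\<beta>\<in>A. (\<alpha>, \<beta>) \<in> k)"

definition bounded_in :: "'u rel \<Rightarrow> 'u set \<Rightarrow> bool" where
  "bounded_in k A \<longleftrightarrow> A \<subseteq> Field k \<and> (\<exists>\<alpha>\<in>Field k. \<forall>\<beta>\<in>A. (\<beta>, \<alpha>) \<in> k)"

text \<open>The inequality is not strict, so that it also makes sense for successor \<open>\<gamma>\<close>.\<close>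

definition cofinal_below :: "'u rel \<Rightarrow> 'u \<Rightarrow> 'u set \<Rightarrow> bool" where
  "cofinal_below k \<gamma> c \<longleftrightarrow>
     c \<subseteq> underS k \<gamma> \<and> (\<forall>\<alpha>\<in>underS k \<gamma>. \<exists>\<beta>\<in>c. (\<alpha>, \<beta>) \<in> k)"

definition limit_in :: "'u rel \<Rightarrow> 'u \<Rightarrow> bool" where
  "limit_in k \<gamma> \<longleftrightarrow> \<gamma> \<in> Field k \<and> underS k \<gamma> \<noteq> {} \<and>
     (\<forall>\<alpha>\<in>underS k \<gamma>. \<exists>\<beta>\<in>underS k \<gamma>. \<alpha> \<in> underS k \<beta>)"

definition club :: "'u rel \<Rightarrow> 'u set \<Rightarrow> bool" where
  "club k C \<longleftrightarrow> unbounded_in k C \<and>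
     (\<forall>\<gamma>. limit_in k \<gamma> \<and> cofinal_below k \<gamma> (C \<inter> underS k \<gamma>) \<longrightarrow> \<gamma> \<in> C)"

text \<open>
  The cofinality of \<open>\<gamma>\<close> is the least order type of a cofinal subset of \<open>\<gamma>\<close>, given as a well-order
  of that type (well-orders up to \<open>=o\<close> are order types).
\<close>

definition cf :: "'u rel \<Rightarrow> 'u \<Rightarrow> 'u rel" where
  "cf k \<gamma> = Restr k (SOME c. cofinal_below k \<gamma> c \<and>
     (\<forall>d. cofinal_below k \<gamma> d \<longrightarrow> Restr k c \<le>o Restr k d))"

text \<open>
  For uncountable \<open>k\<close> these are the usual stationary sets. Stationarity is standardly defined only
  for uncountable \<open>k\<close>, so \<open>k = \<omega>\<close> needs a convention, and we take the sets that are positive for the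
  ideal of bounded sets. The formula ``meets every club'' will not do there: every unbounded
  subset of \<open>\<omega>\<close> is vacuously club, so only cofinite sets would meet them all. Every bipartite
  graph has a good colouring from cofinite lists (even colours on one side, odd ones on the
  other), although the coloring number of bipartite graphs is unbounded.
\<close>

definition stat :: "'u rel \<Rightarrow> 'u set set" where
  "stat k = (if k =o natLeq then {S. unbounded_in k S}
             else {S. S \<subseteq> Field k \<and> (\<forall>C. club k C \<longrightarrow> S \<inter> C \<noteq> {})})"

definition graph :: "'u set \<Rightarrow> 'u set set \<Rightarrow> bool" where
  "graph V E \<longleftrightarrow> E \<subseteq> [V]\<^bsup>2\<^esup>"

definition good :: "'u set \<Rightarrow> 'u set set \<Rightarrow> ('u \<Rightarrow> 'c) \<Rightarrow> bool" where
  "good V E c \<longleftrightarrow> (\<forall>v\<in>V. \<forall>w\<in>V. {v, w} \<in> E \<longrightarrow> c v \<noteq> c w)"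

definition SList :: "'u set \<Rightarrow> 'u set set \<Rightarrow> 'u rel \<Rightarrow> bool" where
  "SList V E k \<longleftrightarrow> (\<forall>L. (\<forall>v\<in>V. L v \<in> stat k) \<longrightarrow>
     (\<exists>c. good V E c \<and> (\<forall>v\<in>V. c v \<in> L v)))"

definition Col :: "'u set \<Rightarrow> 'u set set \<Rightarrow> 'm rel \<Rightarrow> bool" where
  "Col V E m \<longleftrightarrow> (\<exists>r. well_order_on V r \<and>
     (\<forall>v\<in>V. |{w \<in> V. w \<in> underS r v \<and> {v, w} \<in> E}| <o m))"

definition approachability_ideal :: "'u rel \<Rightarrow> 'u set set" (\<open>I[_]\<close>) where
  "I[k] = {S. S \<subseteq> Field k \<and>
     (\<exists>(b :: 'u \<Rightarrow> 'u set) C. (\<forall>\<xi>\<in>Field k. bounded_in k (b \<xi>)) \<and> club k C \<and>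
       (\<forall>\<gamma>\<in>C \<inter> S. \<exists>c. cofinal_below k \<gamma> c \<and> Restr k c =o cf k \<gamma> \<and>
          (\<forall>\<delta>\<in>underS k \<gamma>. \<exists>\<eta>\<in>underS k \<gamma>. c \<inter> underS k \<delta> = b \<eta>)))}"

end

theory Submission
  imports Defs
begin

text \<open>
  Write \<open>s\<close> for the successor of \<open>\<kappa>\<close>. Under GCH there are only \<open>s\<close> stationary sets, which gives
  an obstruction to \<open>SList\<close>: a set \<open>A\<close> of \<open>s\<close> vertices, well-ordered so that every proper initial
  segment has size at most \<open>\<kappa>\<close> and has more than \<open>s\<close> common neighbours. Give every stationary
  set to some vertex of \<open>A\<close>; the set \<open>R\<close> of colours used on \<open>A\<close> then meets every stationary set,
  hence is itself stationary, and it is already used on an initial segment because there are only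
  \<open>\<kappa>\<close> colours. A common neighbour of that segment with list \<open>R\<close> cannot be coloured, and there is
  room to provide one for every segment and every list.

  A counting argument turns this obstruction into a bound: only few vertices have at least \<open>s\<close>
  neighbours in a given set \<open>B\<close>, because their neighbourhoods would contain such an \<open>A\<close> unless they
  are common neighbours of one of few exceptional small subsets of \<open>B\<close>. Hence every set of at least
  \<open>s\<close> vertices has a closure of the same size outside of which every vertex has at most \<open>\<kappa>\<close>
  neighbours in it. Exhausting \<open>V\<close> by an increasing chain of such closures gives (1), as a vertex
  has at most \<open>s\<close> neighbours in a union of a chain of sets in each of which it has at most \<open>\<kappa>\<close>.

  For (2) the unions themselves must be closed. If \<open>|V|\<close> is regular, approachability makes the
  initial segments of a bad neighbourhood of \<open>\<gamma>\<close> appear in a list before \<open>\<gamma>\<close>, so that the same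
  obstruction shows that closed \<open>\<gamma>\<close> form a club. If \<open>|V|\<close> is singular, a version of Shelah's singular
  compactness argument applies.
\<close>

section \<open>Well-orders and cardinals\<close>

lemma notin_underS_iff:
  assumes "Well_order r" "x \<in> Field r" "y \<in> Field r"
  shows "x \<notin> underS r y \<longleftrightarrow> (y, x) \<in> r"
  using assms wo_rel.TOTALS[of r] wo_rel.ANTISYM[of r] wo_rel.REFL[of r]
  unfolding wo_rel_def underS_def antisym_def refl_on_def by blast

lemma underS_trans:
  assumes "Well_order r" "x \<in> underS r y" "(y, z) \<in> r"
  shows "x \<in> underS r z"
  using assms wo_rel.TRANS[of r] wo_rel.ANTISYM[of r]
  unfolding wo_rel_def underS_def trans_def antisym_def by blast

lemma underS_trans2:
  assumes "Well_order r" "(x, y) \<in> r" "y \<in> underS r z"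
  shows "x \<in> underS r z"
  using assms wo_rel.TRANS[of r] wo_rel.ANTISYM[of r]
  unfolding wo_rel_def underS_def trans_def antisym_def by blast

lemma card_of_subset_ordLeq: "A \<subseteq> B \<Longrightarrow> |B| \<le>o k \<Longrightarrow> |A| \<le>o k"
  by (rule ordLeq_transitive[OF card_of_mono1])

lemma card_of_subset_ordLess: "A \<subseteq> B \<Longrightarrow> |B| <o k \<Longrightarrow> |A| <o k"
  by (rule ordLeq_ordLess_trans[OF card_of_mono1])

lemma not_cardSuc_ordLeq_iff:
  assumes "Card_order k"
  shows "\<not> cardSuc k \<le>o |A| \<longleftrightarrow> |A| \<le>o k"
  using assms by (meson cardSuc_Card_order cardSuc_ordLess_ordLeq card_of_Card_order
      card_of_Well_order card_order_on_well_order_on not_ordLess_iff_ordLeq)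

lemma not_ordLeq_card_iff:
  assumes "Card_order k"
  shows "\<not> |A| \<le>o k \<longleftrightarrow> k <o |A|" "\<not> k \<le>o |A| \<longleftrightarrow> |A| <o k"
  using assms by (meson card_of_Well_order card_order_on_well_order_on not_ordLeq_iff_ordLess)+

lemma subset_of_card:
  assumes "Card_order k" "k \<le>o |A|"
  obtains B where "B \<subseteq> A" "|B| =o k"
proof -
  have "|Field k| \<le>o |A|"
    using assms card_of_Field_ordIso ordIso_ordLeq_trans by blast
  then obtain B where "B \<subseteq> A" "|Field k| =o |B|"
    using internalize_card_of_ordLeq2[of "Field k" A] by blast
  then show thesis
    using that ordIso_transitive[OF ordIso_symmetric card_of_Field_ordIso[OF assms(1)]] by blast
qed

lemma regular_bounded:
  assumes "Cinfinite r" "regularCard r" "A \<subseteq> Field r" "|A| <o r"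
  shows "\<exists>x\<in>Field r. A \<subseteq> underS r x"
proof -
  have wo: "Well_order r" using assms(1) card_order_on_well_order_on by blast
  have "\<not> cofinal A r"
    using assms unfolding regularCard_def using not_ordLess_ordIso by blast
  then obtain a where a: "a \<in> Field r" "\<And>b. b \<in> A \<Longrightarrow> a = b \<or> (a, b) \<notin> r"
    unfolding cofinal_def by blast
  \<comment> \<open>An infinite cardinal has no last element, which turns the weak bound into a
    strict one.\<close>
  obtain a' where a': "a' \<in> Field r" "a \<noteq> a'" "(a, a') \<in> r"
    using assms(1) a(1) infinite_Card_order_limit unfolding cinfinite_def by metis
  have "b \<in> underS r a'" if "b \<in> A" for b
  proof -
    have "(b, a) \<in> r"
      using a that assms(3) notin_underS_iff[OF wo, of b a] notin_underS_iff[OF wo, of a b]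
        wo_rel.TOTALS[of r] wo unfolding wo_rel_def by blast
    then show ?thesis
      using a' underS_trans2[OF wo, of b a a'] by (simp add: underS_def)
  qed
  then show ?thesis using a'(1) by blast
qed

lemma Cinfinite_Well_order: "Cinfinite k \<Longrightarrow> Well_order k"
  using card_order_on_well_order_on by blast

lemma exists_greater:
  assumes "Cinfinite k" "a \<in> Field k"
  obtains b where "b \<in> Field k" "a \<in> underS k b"
  using assms infinite_Card_order_limit[of k a]
  unfolding cinfinite_def underS_def by blast

lemma card_of_under:
  assumes "Cinfinite k" "a \<in> Field k"
  shows "|under k a| <o k"
proof -
  obtain b where b: "b \<in> Field k" "a \<in> underS k b" using exists_greater[OF assms] .
  have "under k a \<subseteq> underS k b"
    using underS_trans2[OF Cinfinite_Well_order[OF assms(1)] _ b(2)] unfolding under_def by blast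
  moreover have "|underS k b| <o k"
    using assms(1) by (intro card_of_underS[OF _ b(1)]) simp
  ultimately show ?thesis by (rule card_of_subset_ordLess)
qed

section \<open>Pigeonhole, unions of chains and distinct representatives\<close>

lemma pigeonhole_cardSuc:
  assumes k: "Cinfinite k" and I: "|I| \<le>o k" and A: "A \<subseteq> (\<Union>i\<in>I. F i)" "cardSuc k \<le>o |A|"
  obtains i where "i \<in> I" "cardSuc k \<le>o |A \<inter> F i|"
proof (rule ccontr)
  assume "\<not> thesis"
  then have "\<forall>i\<in>I. |A \<inter> F i| \<le>o k"
    using that not_cardSuc_ordLeq_iff[of k] k by blast
  then have "|\<Union>i\<in>I. A \<inter> F i| \<le>o k"
    using I k by (intro UNION_Cinfinite_bound)
  then have "|A| \<le>o k"
    by (rule card_of_subset_ordLeq[rotated]) (use A(1) in blast)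
  then show False using A(2) not_cardSuc_ordLeq_iff[of k A] k by blast
qed

text \<open>If the union were too large, it would contain a set \<open>W\<close> of size
  \<open>cardSuc k\<close>. No member of the chain includes \<open>W\<close>, so each member misses
  some \<open>w\<close> and lies inside a chosen member containing \<open>w\<close>. Thus
  \<open>cardSuc k\<close> members of size at most \<open>k\<close> already cover the union. This
  loss of one cardinal is what separates the bound in (1) from that in (2).\<close>

lemma card_of_Union_chain:
  assumes k: "Cinfinite k" and chain: "\<And>X Y. X \<in> \<F> \<Longrightarrow> Y \<in> \<F> \<Longrightarrow> X \<subseteq> Y \<or> Y \<subseteq> X"
    and small: "\<And>X. X \<in> \<F> \<Longrightarrow> |X| \<le>o k"
  shows "|\<Union>\<F>| \<le>o cardSuc k"
proof (rule ccontr)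
  assume large: "\<not> ?thesis"
  have s: "Cinfinite (cardSuc k)" "k <o cardSuc k"
    using k Cinfinite_cardSuc cardSuc_greater by auto
  then have "cardSuc k \<le>o |\<Union>\<F>|"
    using large not_ordLeq_card_iff ordLess_imp_ordLeq by blast
  then obtain W where W: "W \<subseteq> \<Union>\<F>" "|W| =o cardSuc k"
    using subset_of_card s(1) by metis
  then have "\<forall>w\<in>W. \<exists>X\<in>\<F>. w \<in> X" by blast
  then obtain X where X: "\<And>w. w \<in> W \<Longrightarrow> X w \<in> \<F> \<and> w \<in> X w" by metis
  have "\<not> W \<subseteq> Y" if "Y \<in> \<F>" for Y
  proof
    assume "W \<subseteq> Y"
    then have "cardSuc k \<le>o k"
      using ordIso_ordLeq_trans[OF ordIso_symmetric[OF W(2)] card_of_subset_ordLeq[OF _ small[OF that]]]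
      by blast
    then show False using s(2) not_ordLess_ordLeq by blast
  qed
  then have cov: "\<Union>\<F> \<subseteq> (\<Union>w\<in>W. X w)"
  proof (intro subsetI, elim UnionE)
    fix x Y assume Y: "x \<in> Y" "Y \<in> \<F>"
    then obtain w where w: "w \<in> W" "w \<notin> Y" using \<open>\<And>Y. Y \<in> \<F> \<Longrightarrow> \<not> W \<subseteq> Y\<close> by blast
    then have "Y \<subseteq> X w" using X chain[OF Y(2), of "X w"] by blast
    then show "x \<in> (\<Union>w\<in>W. X w)" using Y w by blast
  qed
  have "|\<Union>w\<in>W. X w| \<le>o cardSuc k"
  proof (rule UNION_Cinfinite_bound[OF ordIso_imp_ordLeq[OF W(2)] _ s(1)], rule ballI)
    fix w assume "w \<in> W"
    then have "|X w| \<le>o k" using X small by blast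
    then show "|X w| \<le>o cardSuc k"
      by (rule ordLeq_transitive[OF _ ordLess_imp_ordLeq[OF s(2)]])
  qed
  with cov have "|\<Union>\<F>| \<le>o cardSuc k" by (rule card_of_subset_ordLeq)
  then show False using large by simp
qed

text \<open>Transfinite recursion along the cardinal well-order of \<open>I\<close>: fewer than
  \<open>r\<close> values have been chosen before \<open>i\<close>, so \<open>W i\<close> still
  contains a fresh element.\<close>

lemma distinct_representatives:
  assumes r: "Card_order r" and I: "|I| \<le>o r" and W: "\<And>i. i \<in> I \<Longrightarrow> r \<le>o |W i|"
  shows "\<exists>f. inj_on f I \<and> (\<forall>i\<in>I. f i \<in> W i)"
proof -
  define R where "R = |I| - Id"
  have wo: "Well_order |I|" by (rule card_of_Well_order)
  have wf: "wf R"
    using wo unfolding R_def well_order_on_def by blast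
  define f where "f = wfrec R (\<lambda>g i. SOME x. x \<in> W i - g ` underS |I| i)"
  \<comment> \<open>\<open>R\<close> is the strict part of the well-order, so the recursion guard
    \<open>cut\<close> changes nothing on the predecessors of \<open>i\<close>.\<close>
  have cut: "cut f R i ` underS |I| i = f ` underS |I| i" for i
    by (rule image_cong) (auto simp: cut_def R_def underS_def)
  have f: "f i = (SOME x. x \<in> W i - f ` underS |I| i)" for i
    using wfrec[OF wf, of "\<lambda>g i. SOME x. x \<in> W i - g ` underS |I| i" i] cut
    unfolding f_def by simp
  have in_W: "f i \<in> W i - f ` underS |I| i" if i: "i \<in> I" for i
  proof -
    have "|f ` underS |I| i| <o |W i|"
    proof -
      have "|underS |I| i| <o |I|"
        using i card_of_underS[OF card_of_Card_order, of i I] by (simp add: Field_card_of)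
      then show ?thesis
        by (rule ordLeq_ordLess_trans[OF card_of_image
            ordLess_ordLeq_trans[OF _ ordLeq_transitive[OF I W[OF i]]]])
    qed
    then have "\<not> W i \<subseteq> f ` underS |I| i"
      using card_of_mono1 not_ordLess_ordLeq by blast
    then show ?thesis unfolding f[of i] by (metis (mono_tags, lifting) DiffI someI_ex subsetI)
  qed
  have "inj_on f I"
  proof (rule inj_onI, rule ccontr)
    fix i j assume ij: "i \<in> I" "j \<in> I" "f i = f j" "i \<noteq> j"
    then have "i \<in> underS |I| j \<or> j \<in> underS |I| i"
      using wo_rel.TOTALS[of "|I|"] wo unfolding wo_rel_def underS_def by (auto simp: Field_card_of)
    then show False using in_W[OF ij(1)] in_W[OF ij(2)] ij(3) by (metis DiffE imageI)
  qed
  then show ?thesis using in_W by blast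
qed

section \<open>Coloring numbers of layered graphs\<close>

text \<open>The fibres of \<open>\<rho>\<close> are stacked in the order \<open>r\<close>, each
  carrying its own well-order. The earlier neighbours of a vertex lie either in lower fibres,
  bounded by \<open>down\<close>, or in its own fibre, bounded by \<open>fibre\<close>.\<close>

lemma Col_assemble:
  fixes V :: "'u set" and r :: "'i rel"
  assumes r: "Well_order r" and rho: "\<And>v. v \<in> V \<Longrightarrow> \<rho> v \<in> Field r" and m: "Cinfinite m"
    and fibre: "\<And>i. i \<in> Field r \<Longrightarrow> Col {v\<in>V. \<rho> v = i} E m"
    and down: "\<And>v. v \<in> V \<Longrightarrow> |{w\<in>V. \<rho> w \<in> underS r (\<rho> v) \<and> {v, w} \<in> E}| <o m"
  shows "Col V E m"
proof -
  have "\<forall>i\<in>Field r. \<exists>q. well_order_on {v\<in>V. \<rho> v = i} q \<and>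
      (\<forall>v\<in>{v\<in>V. \<rho> v = i}. |{w\<in>{v\<in>V. \<rho> v = i}. w \<in> underS q v \<and> {v, w} \<in> E}| <o m)"
    using fibre unfolding Col_def by blast
  from bchoice[OF this] obtain q where
    q: "\<And>i. i \<in> Field r \<Longrightarrow> well_order_on {v\<in>V. \<rho> v = i} (q i)" and
    q_less': "\<And>i v. i \<in> Field r \<Longrightarrow> v \<in> {v\<in>V. \<rho> v = i} \<Longrightarrow>
      |{w\<in>{v\<in>V. \<rho> v = i}. w \<in> underS (q i) v \<and> {v, w} \<in> E}| <o m"
    by blast
  have q_less: "|{w\<in>V. \<rho> w = \<rho> v \<and> w \<in> underS (q (\<rho> v)) v \<and> {v, w} \<in> E}| <o m"
    if "v \<in> V" for v
    using q_less'[OF rho[OF that], of v] that by (simp add: conj_assoc)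
  define R where "R = {(v, w). v \<in> V \<and> w \<in> V \<and>
    (\<rho> v \<in> underS r (\<rho> w) \<or> \<rho> v = \<rho> w \<and> (v, w) \<in> q (\<rho> v))}"
  have q_wo: "q (\<rho> v) \<subseteq> {u\<in>V. \<rho> u = \<rho> v} \<times> {u\<in>V. \<rho> u = \<rho> v}"
      "refl_on {u\<in>V. \<rho> u = \<rho> v} (q (\<rho> v))" "trans (q (\<rho> v))" "antisym (q (\<rho> v))"
      "total_on {u\<in>V. \<rho> u = \<rho> v} (q (\<rho> v))" "wf (q (\<rho> v) - Id)" if "v \<in> V" for v
    using q[OF rho[OF that]] unfolding well_order_on_def linear_order_on_def partial_order_on_def
      preorder_on_def by simp_all
  have "(v, v) \<in> q (\<rho> v)" if "v \<in> V" for v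
    using q_wo(2)[OF that] that unfolding refl_on_def by simp
  then have refl: "refl_on V R"
    unfolding refl_on_def R_def by simp
  have nin: "\<rho> w \<notin> underS r (\<rho> v)" if "\<rho> v \<in> underS r (\<rho> w)" for v w
    using underS_trans2[OF r, of "\<rho> v" "\<rho> w" "\<rho> v"] that underS_notIn[of "\<rho> v" r]
    by (auto simp: underS_def)
  have "antisym R"
  proof (rule antisymI)
    fix v w assume vw: "(v, w) \<in> R" "(w, v) \<in> R"
    then have "v \<in> V" by (auto simp: R_def)
    then have "antisym (q (\<rho> v))" by (rule q_wo(4))
    moreover have eq: "\<rho> v = \<rho> w"
      using vw nin[of v w] unfolding R_def mem_Collect_eq split_conv by metis
    moreover have "\<rho> v \<notin> underS r (\<rho> w)" "\<rho> w \<notin> underS r (\<rho> v)"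
      unfolding eq by (rule underS_notIn)+
    then have "(v, w) \<in> q (\<rho> v)" "(w, v) \<in> q (\<rho> v)"
      using vw eq unfolding R_def by simp_all
    ultimately show "v = w" by (meson antisymD)
  qed
  moreover have "trans R"
  proof (rule transI)
    fix u v w assume uvw: "(u, v) \<in> R" "(v, w) \<in> R"
    then have "u \<in> V" by (auto simp: R_def)
    then have "trans (q (\<rho> u))" by (rule q_wo(3))
    then have tq: "(u, w) \<in> q (\<rho> u)" if "(u, v) \<in> q (\<rho> u)" "(v, w) \<in> q (\<rho> u)"
      using that by (rule transD)
    have "\<rho> u \<in> underS r (\<rho> w)" if "\<rho> u \<in> underS r (\<rho> v)" "\<rho> v \<in> underS r (\<rho> w)"
      by (rule underS_trans[OF r that(1)]) (use that(2) in \<open>simp add: underS_def\<close>)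
    then show "(u, w) \<in> R" using uvw tq unfolding R_def by auto
  qed
  moreover have "total_on V R"
  proof (rule total_onI)
    fix v w assume vw: "v \<in> V" "w \<in> V" "v \<noteq> w"
    have "total_on {u\<in>V. \<rho> u = \<rho> v} (q (\<rho> v))"
      by (rule q_wo(5)[OF vw(1)])
    moreover have "\<rho> v \<noteq> \<rho> w \<Longrightarrow> \<rho> v \<in> underS r (\<rho> w) \<or> \<rho> w \<in> underS r (\<rho> v)"
      using notin_underS_iff[OF r rho[OF vw(1)] rho[OF vw(2)]] by (auto simp: underS_def)
    ultimately show "(v, w) \<in> R \<or> (w, v) \<in> R"
      using vw unfolding R_def total_on_def by force
  qed
  moreover have "wf (R - Id)"
  proof (rule wfI_min)
    fix x :: 'u and Q assume x: "x \<in> Q"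
    show "\<exists>z\<in>Q. \<forall>y. (y, z) \<in> R - Id \<longrightarrow> y \<notin> Q"
    proof (cases "Q \<inter> V = {}")
      case True
      then show ?thesis using x unfolding R_def by blast
    next
      case False
      \<comment> \<open>A least element is found by minimising the fibre first and then the position
        inside it.\<close>
      have "wf (r - Id)" using r unfolding well_order_on_def by blast
      then obtain z where z: "z \<in> Q \<inter> V" "\<And>y. (\<rho> y, \<rho> z) \<in> r - Id \<Longrightarrow> y \<notin> Q \<inter> V"
        using False wf_inv_image[of "r - Id" \<rho>] unfolding wf_eq_minimal in_inv_image
        by (metis ex_in_conv)
      have "wf (q (\<rho> z) - Id)" using q_wo(6) z(1) by blast
      then obtain y where y: "y \<in> {y\<in>Q \<inter> V. \<rho> y = \<rho> z}"
        "\<And>u. (u, y) \<in> q (\<rho> z) - Id \<Longrightarrow> u \<notin> {y\<in>Q \<inter> V. \<rho> y = \<rho> z}"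
        using z(1) unfolding wf_eq_minimal by (metis (mono_tags, lifting) mem_Collect_eq)
      show ?thesis
      proof (intro bexI allI impI notI)
        fix u assume u: "(u, y) \<in> R - Id" "u \<in> Q"
        then have "u \<in> V" by (auto simp: R_def)
        then show False using u y z(2)[of u] unfolding R_def underS_def by auto
      qed (use y in blast)
    qed
  qed
  ultimately have wo: "well_order_on V R"
    using refl unfolding well_order_on_def linear_order_on_def partial_order_on_def preorder_on_def
    by (auto simp: R_def)
  moreover have "|{w\<in>V. w \<in> underS R v \<and> {v, w} \<in> E}| <o m" if v: "v \<in> V" for v
  proof -
    have "{w\<in>V. w \<in> underS R v \<and> {v, w} \<in> E} \<subseteq> {w\<in>V. \<rho> w \<in> underS r (\<rho> v) \<and> {v, w} \<in> E}
      \<union> {w\<in>V. \<rho> w = \<rho> v \<and> w \<in> underS (q (\<rho> v)) v \<and> {v, w} \<in> E}"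
      unfolding R_def underS_def by auto
    moreover have "|{w\<in>V. \<rho> w \<in> underS r (\<rho> v) \<and> {v, w} \<in> E}
      \<union> {w\<in>V. \<rho> w = \<rho> v \<and> w \<in> underS (q (\<rho> v)) v \<and> {v, w} \<in> E}| <o m"
      using down[OF v] q_less[OF v] m by (intro Un_Cinfinite_bound_strict) auto
    ultimately show ?thesis by (rule card_of_subset_ordLess)
  qed
  ultimately show ?thesis unfolding Col_def by blast
qed

text \<open>Proper initial segments of the cardinal well-order of \<open>V\<close> are smaller than
  \<open>|V|\<close>, whatever the edges are.\<close>

lemma Col_small:
  assumes "Card_order m" "|V| \<le>o m"
  shows "Col V E m"
  unfolding Col_def
proof (intro exI[of _ "|V|"] conjI ballI)
  fix v assume "v \<in> V"
  then have "|underS |V| v| <o m"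
    using card_of_underS[OF card_of_Card_order, of v V] ordLess_ordLeq_trans[OF _ assms(2)]
    by (simp add: Field_card_of)
  then show "|{w \<in> V. w \<in> underS |V| v \<and> {v, w} \<in> E}| <o m"
    by (rule card_of_subset_ordLess[rotated]) blast
qed (rule card_of_well_order_on)

section \<open>Clubs and stationary sets\<close>

lemma regular_cardinalD:
  assumes "regular_cardinal k"
  shows "Cinfinite k" "regularCard k" "Card_order k" "Field k \<noteq> {}"
  using assms unfolding regular_cardinal_def cinfinite_def by auto

lemma regular_cardinal_wo: "regular_cardinal k \<Longrightarrow> Well_order k"
  unfolding regular_cardinal_def using card_order_on_well_order_on by blast

lemma underS_in_Field: "a \<in> underS r b \<Longrightarrow> a \<in> Field r"
  unfolding underS_def Field_def by auto

lemma underS_underS: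
  "Well_order r \<Longrightarrow> a \<in> underS r b \<Longrightarrow> b \<in> underS r c \<Longrightarrow> a \<in> underS r c"
  by (rule underS_trans) (auto simp: underS_def)

lemma underS_imp_le: "a \<in> underS r b \<Longrightarrow> (a, b) \<in> r"
  unfolding underS_def by simp

text \<open>Regularity and uncountability bound the countable sequence, and its least strict upper
  bound is the limit. The unboundedness of both clubs constructed below rests on this.\<close>

lemma limit_of_sequence:
  assumes k: "regular_cardinal k" "\<not> k =o natLeq"
    and x: "\<And>n. x n \<in> Field k" "\<And>n :: nat. x n \<in> underS k (x (Suc n))"
  obtains \<gamma> where "limit_in k \<gamma>" "\<And>n. x n \<in> underS k \<gamma>"
    "\<And>\<alpha>. \<alpha> \<in> underS k \<gamma> \<Longrightarrow> \<exists>n. \<alpha> \<in> underS k (x n)"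
proof -
  have wo: "Well_order k" using k(1) by (rule regular_cardinal_wo)
  have "natLeq <o k"
    using k natLeq_ordLeq_cinfinite[of k] ordLeq_iff_ordLess_or_ordIso[of natLeq k]
      ordIso_symmetric[of natLeq k] unfolding regular_cardinal_def by blast
  then have "|range x| <o k"
    using ordLeq_ordLess_trans[OF card_of_image ordIso_ordLess_trans[OF card_of_nat]] by blast
  then obtain b where b: "b \<in> Field k" "range x \<subseteq> underS k b"
    using regular_bounded[of k "range x"] k(1) x(1) unfolding regular_cardinal_def by blast
  define B where "B = {y\<in>Field k. \<forall>n. x n \<in> underS k y}"
  have B: "B \<noteq> {}" "B \<subseteq> Field k" using b unfolding B_def by auto
  define \<gamma> where "\<gamma> = wo_rel.minim k B"
  have \<gamma>: "\<gamma> \<in> B" "\<And>y. y \<in> B \<Longrightarrow> (\<gamma>, y) \<in> k"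
    using wo_rel.minim_in[of k B] wo_rel.minim_least[of k B] B wo
    unfolding \<gamma>_def wo_rel_def by auto
  have below: "\<exists>n. \<alpha> \<in> underS k (x n)" if \<alpha>: "\<alpha> \<in> underS k \<gamma>" for \<alpha>
  proof -
    have \<alpha>F: "\<alpha> \<in> Field k" using \<alpha> by (rule underS_in_Field)
    have "\<alpha> \<notin> B" using \<gamma> \<alpha> notin_underS_iff[OF wo \<alpha>F, of \<gamma>] B by blast
    then obtain n where "x n \<notin> underS k \<alpha>" using \<alpha>F unfolding B_def by blast
    then have "(\<alpha>, x n) \<in> k" using notin_underS_iff[OF wo x(1) \<alpha>F] by blast
    then show ?thesis using underS_trans2[OF wo _ x(2)] by blast
  qed
  have x\<gamma>: "x n \<in> underS k \<gamma>" for n using \<gamma>(1) unfolding B_def by blast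
  have "limit_in k \<gamma>" using below x\<gamma> \<gamma>(1) unfolding limit_in_def B_def by blast
  then show thesis using that x\<gamma> below by blast
qed

text \<open>An increasing sequence alternating between \<open>C\<close> and \<open>D\<close> has a
  supremum that is a limit of points of both, hence in both. For \<open>k\<close> of type \<omega>
  this would fail, since there every unbounded set is a club.\<close>

lemma club_Int:
  assumes k: "regular_cardinal k" "\<not> k =o natLeq" and C: "club k C" and D: "club k D"
  shows "club k (C \<inter> D)"
proof -
  have wo: "Well_order k" using k(1) by (rule regular_cardinal_wo)
  have next_in: "\<exists>c. c \<in> X \<and> a \<in> underS k c" if X: "club k X" and a: "a \<in> Field k" for X a
  proof -
    obtain b where b: "b \<in> Field k" "a \<in> underS k b" using exists_greater[OF regular_cardinalD(1)[OF k(1)] a] .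
    then obtain c where "c \<in> X" "(b, c) \<in> k"
      using X unfolding club_def unbounded_in_def by blast
    then show ?thesis using underS_trans[OF wo b(2)] by blast
  qed
  have sub: "C \<subseteq> Field k" "D \<subseteq> Field k"
    using C D unfolding club_def unbounded_in_def by auto
  have "\<forall>a\<in>Field k. \<exists>c. c \<in> C \<and> a \<in> underS k c" "\<forall>a\<in>Field k. \<exists>c. c \<in> D \<and> a \<in> underS k c"
    using next_in[OF C] next_in[OF D] by simp_all
  from bchoice[OF this(1)] bchoice[OF this(2)] obtain f g where
    f: "\<And>a. a \<in> Field k \<Longrightarrow> f a \<in> C \<and> a \<in> underS k (f a)" and
    g: "\<And>a. a \<in> Field k \<Longrightarrow> g a \<in> D \<and> a \<in> underS k (g a)" by blast
  have fF: "f a \<in> Field k" if "a \<in> Field k" for a using f[OF that] sub by blast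
  have "\<exists>\<beta>\<in>C \<inter> D. (\<alpha>, \<beta>) \<in> k" if \<alpha>: "\<alpha> \<in> Field k" for \<alpha>
  proof -
    \<comment> \<open>One round steps into \<open>C\<close> by \<open>f\<close> and then into
      \<open>D\<close> by \<open>g\<close>.\<close>
    define x where "x n = ((\<lambda>a. g (f a)) ^^ n) \<alpha>" for n
    have xS: "x (Suc n) = g (f (x n))" "x 0 = \<alpha>" for n unfolding x_def by simp_all
    have xF: "x n \<in> Field k" for n
    proof (induction n)
      case (Suc n)
      then show ?case using g[OF fF[OF Suc]] sub xS(1) by auto
    qed (simp add: xS(2) \<alpha>)
    have fx: "x n \<in> underS k (f (x n))" "f (x n) \<in> underS k (x (Suc n))" for n
      using f[OF xF[of n]] g[OF fF[OF xF[of n]]] by (simp_all add: xS(1))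
    have "x n \<in> underS k (x (Suc n))" for n
      using fx by (rule underS_underS[OF wo])
    from limit_of_sequence[of k x, OF k xF this] obtain \<gamma> where
      \<gamma>: "limit_in k \<gamma>" "\<And>n. x n \<in> underS k \<gamma>"
      "\<And>a. a \<in> underS k \<gamma> \<Longrightarrow> \<exists>n. a \<in> underS k (x n)" by blast
    have fC: "f (x n) \<in> C \<inter> underS k \<gamma>" for n
      using f[OF xF[of n]] underS_underS[OF wo fx(2) \<gamma>(2), of n] by simp
    have gD: "x (Suc n) \<in> D \<inter> underS k \<gamma>" for n
      using g[OF fF[OF xF[of n]]] \<gamma>(2)[of "Suc n"] by (simp add: xS(1))
    have leC: "(a, f (x n)) \<in> k" if "a \<in> underS k (x n)" for a n
      using underS_underS[OF wo that fx(1)] by (rule underS_imp_le)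
    have leD: "(a, x (Suc n)) \<in> k" if "a \<in> underS k (x n)" for a n
      using underS_underS[OF wo underS_underS[OF wo that fx(1)] fx(2)] by (rule underS_imp_le)
    have cofI: "cofinal_below k \<gamma> (X \<inter> underS k \<gamma>)"
      if "\<And>n. h n \<in> X \<inter> underS k \<gamma>" "\<And>a n. a \<in> underS k (x n) \<Longrightarrow> (a, h n) \<in> k" for X h
      unfolding cofinal_below_def
    proof (intro conjI ballI)
      fix a assume "a \<in> underS k \<gamma>"
      then obtain n where "a \<in> underS k (x n)" using \<gamma>(3) by blast
      then show "\<exists>\<beta>\<in>X \<inter> underS k \<gamma>. (a, \<beta>) \<in> k" using that by blast
    qed simp
    have "\<gamma> \<in> C" "\<gamma> \<in> D"
      using C D \<gamma>(1) cofI[of "\<lambda>n. f (x n)" C, OF fC leC] cofI[of "\<lambda>n. x (Suc n)" D, OF gD leD]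
      unfolding club_def by simp_all
    then have "\<gamma> \<in> C \<inter> D" by simp
    moreover have "(\<alpha>, \<gamma>) \<in> k" using underS_imp_le[OF \<gamma>(2)[of 0]] xS(2) by simp
    ultimately show ?thesis by blast
  qed
  moreover have "cofinal_below k \<gamma> (C \<inter> underS k \<gamma>) \<and> cofinal_below k \<gamma> (D \<inter> underS k \<gamma>)"
    if "cofinal_below k \<gamma> (C \<inter> D \<inter> underS k \<gamma>)" for \<gamma>
    using that unfolding cofinal_below_def by (metis Int_iff Int_lower2)
  moreover have "C \<inter> D \<subseteq> Field k" using sub by blast
  ultimately show ?thesis
    using C D unfolding club_def unbounded_in_def by simp
qed

text \<open>Regularity bounds the values of \<open>g\<close> below each \<open>a\<close> by some
  \<open>h a\<close>; after \<omega> applications of \<open>h\<close> the supremum absorbs its own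
  \<open>g\<close>-values.\<close>

lemma club_closure_points:
  assumes k: "regular_cardinal k" "\<not> k =o natLeq"
    and g: "\<And>a. a \<in> Field k \<Longrightarrow> g a \<in> Field k"
  shows "club k {\<gamma>. limit_in k \<gamma> \<and> (\<forall>\<eta>\<in>underS k \<gamma>. g \<eta> \<in> underS k \<gamma>)}" (is "club k ?C")
proof -
  have wo: "Well_order k" using k(1) by (rule regular_cardinal_wo)
  have "\<forall>a\<in>Field k. \<exists>b. b \<in> Field k \<and> a \<in> underS k b \<and> g ` underS k a \<subseteq> underS k b"
  proof
    fix a assume a: "a \<in> Field k"
    have reg: "Cinfinite k" "regularCard k" using k(1) unfolding regular_cardinal_def by auto
    \<comment> \<open>Including \<open>a\<close> itself makes the bound larger than
      \<open>a\<close>.\<close>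
    have "|insert a (g ` underS k a)| <o k"
    proof -
      have "|g ` underS k a| <o k"
        by (rule ordLeq_ordLess_trans[OF card_of_image card_of_underS]) (use reg a in auto)
      moreover have "|{a}| <o k"
        using reg(1) card_of_Card_order[of "{a}"]
        by (intro Cfinite_ordLess_Cinfinite) (simp_all add: cfinite_def Field_card_of)
      ultimately show ?thesis using Un_Cinfinite_bound_strict[of "{a}" k] reg(1) by simp
    qed
    moreover have "insert a (g ` underS k a) \<subseteq> Field k"
      using a g underS_in_Field[of _ k a] by blast
    ultimately show "\<exists>b. b \<in> Field k \<and> a \<in> underS k b \<and> g ` underS k a \<subseteq> underS k b"
      using regular_bounded[OF reg] by (metis insert_subset)
  qed
  from bchoice[OF this] obtain h where h: "\<And>a. a \<in> Field k \<Longrightarrow> h a \<in> Field k \<and>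
    a \<in> underS k (h a) \<and> g ` underS k a \<subseteq> underS k (h a)" by blast
  have "\<exists>\<gamma>\<in>?C. (\<alpha>, \<gamma>) \<in> k" if \<alpha>: "\<alpha> \<in> Field k" for \<alpha>
  proof -
    define x where "x n = (h ^^ n) \<alpha>" for n
    have xS: "x (Suc n) = h (x n)" "x 0 = \<alpha>" for n unfolding x_def by simp_all
    have xF: "x n \<in> Field k" for n by (induction n) (use \<alpha> h xS in auto)
    have "x n \<in> underS k (x (Suc n))" for n using h[OF xF] xS(1) by simp
    from limit_of_sequence[of k x, OF k xF this] obtain \<gamma> where
      \<gamma>: "limit_in k \<gamma>" "\<And>n. x n \<in> underS k \<gamma>"
      "\<And>a. a \<in> underS k \<gamma> \<Longrightarrow> \<exists>n. a \<in> underS k (x n)" by blast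
    have "g \<eta> \<in> underS k \<gamma>" if \<eta>: "\<eta> \<in> underS k \<gamma>" for \<eta>
    proof -
      obtain n where "\<eta> \<in> underS k (x n)" using \<gamma>(3) \<eta> by blast
      then have "g \<eta> \<in> underS k (x (Suc n))" using h[OF xF] xS by auto
      then show ?thesis
        by (rule underS_trans[OF wo]) (use \<gamma>(2)[of "Suc n"] in \<open>simp add: underS_def\<close>)
    qed
    then show ?thesis using \<gamma> xS(2) unfolding underS_def by (intro bexI[of _ \<gamma>]) auto
  qed
  moreover have "\<gamma> \<in> ?C" if \<gamma>: "limit_in k \<gamma>" "cofinal_below k \<gamma> (?C \<inter> underS k \<gamma>)" for \<gamma>
  proof -
    have "g \<eta> \<in> underS k \<gamma>" if \<eta>: "\<eta> \<in> underS k \<gamma>" for \<eta>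
    proof -
      obtain \<alpha> where \<alpha>: "\<alpha> \<in> underS k \<gamma>" "\<eta> \<in> underS k \<alpha>" using \<gamma>(1) \<eta> unfolding limit_in_def by blast
      then obtain \<beta> where \<beta>: "\<beta> \<in> ?C" "\<beta> \<in> underS k \<gamma>" "(\<alpha>, \<beta>) \<in> k"
        using \<gamma>(2) unfolding cofinal_below_def by blast
      then have "g \<eta> \<in> underS k \<beta>" using underS_trans[OF wo \<alpha>(2)] by blast
      then show ?thesis
        by (rule underS_trans[OF wo]) (use \<beta>(2) in \<open>simp add: underS_def\<close>)
    qed
    then show ?thesis using \<gamma>(1) by blast
  qed
  moreover have "?C \<subseteq> Field k" unfolding limit_in_def by blast
  ultimately show ?thesis unfolding club_def unbounded_in_def by blast
qed

text \<open>If \<open>S\<close> misses a club \<open>C\<close>, its complement contains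
  \<open>C\<close>, which meets every other club because clubs intersect in nonempty clubs. For
  \<open>k\<close> of type \<omega>, the complement of a bounded set is unbounded.\<close>

lemma stat_complement:
  assumes k: "regular_cardinal k" and S: "S \<subseteq> Field k" "S \<notin> stat k"
  shows "Field k - S \<in> stat k"
proof (cases "k =o natLeq")
  case True
  then obtain \<alpha> where \<alpha>: "\<alpha> \<in> Field k" "\<And>\<beta>. \<beta> \<in> S \<Longrightarrow> (\<alpha>, \<beta>) \<notin> k"
    using S unfolding stat_def unbounded_in_def by auto
  have "\<exists>\<beta>\<in>Field k - S. (a, \<beta>) \<in> k" if a: "a \<in> Field k" for a
  proof -
    have wo: "wo_rel k" using regular_cardinal_wo[OF k] by (simp add: wo_rel_def)
    define \<beta> where "\<beta> = wo_rel.max2 k \<alpha> a"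
    have "(\<alpha>, \<beta>) \<in> k" "(a, \<beta>) \<in> k" "\<beta> = \<alpha> \<or> \<beta> = a"
      using wo_rel.max2_greater_among[OF wo \<alpha>(1) a] unfolding \<beta>_def by auto
    then show ?thesis using \<alpha> a by blast
  qed
  then show ?thesis using True unfolding stat_def unbounded_in_def by auto
next
  case False
  then obtain C where C: "club k C" "S \<inter> C = {}" using S unfolding stat_def by auto
  have "(Field k - S) \<inter> D \<noteq> {}" if D: "club k D" for D
  proof -
    have "club k (C \<inter> D)" using club_Int[OF k False C(1) D] .
    moreover have "Field k \<noteq> {}" using k unfolding regular_cardinal_def cinfinite_def by auto
    ultimately obtain x where "x \<in> C \<inter> D" "x \<in> Field k"
      unfolding club_def unbounded_in_def by blast
    then show ?thesis using C(2) by blast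
  qed
  then show ?thesis using False unfolding stat_def by auto
qed

lemma stat_subset: "S \<in> stat k \<Longrightarrow> S \<subseteq> Field k"
  unfolding stat_def unbounded_in_def by (auto split: if_splits)

text \<open>Supplies the default list for vertices whose colour does not matter.\<close>

lemma Field_in_stat:
  assumes k: "regular_cardinal k"
  shows "Field k \<in> stat k"
proof -
  have F: "Field k \<noteq> {}" using k unfolding regular_cardinal_def cinfinite_def by auto
  have "(a, a) \<in> k" if "a \<in> Field k" for a
    using notin_underS_iff[OF regular_cardinal_wo[OF k] that that] underS_notIn[of a k] by simp
  then have "club k (Field k)"
    unfolding club_def unbounded_in_def limit_in_def by auto
  then have "{} \<notin> stat k" using F unfolding stat_def unbounded_in_def by auto
  then show ?thesis using stat_complement[OF k, of "{}"] by simp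
qed

section \<open>The obstruction to stationary list colourings\<close>

definition common_nbrs :: "'u set \<Rightarrow> 'u set set \<Rightarrow> 'u set \<Rightarrow> 'u set" where
  "common_nbrs V E K = {v\<in>V. \<forall>w\<in>K. {v, w} \<in> E}"

definition nbrs_in :: "'u set set \<Rightarrow> 'u \<Rightarrow> 'u set \<Rightarrow> 'u set" where
  "nbrs_in E v B = {w\<in>B. {v, w} \<in> E}"

lemma GCH_Pow:
  assumes "GCH TYPE('u)" "infinite (A :: 'u set)"
  shows "|Pow A| =o cardSuc |A|"
  using assms unfolding GCH_def by blast

lemma GCH_Pow_Field:
  fixes k :: "'u rel"
  assumes "GCH TYPE('u)" "Cinfinite k"
  shows "|Pow (Field k)| =o cardSuc k"
proof -
  have "|Pow (Field k)| =o cardSuc |Field k|"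
    using assms by (intro GCH_Pow) (simp_all add: cinfinite_def)
  also have "cardSuc |Field k| =o cardSuc k"
    using assms(2) cardSuc_invar_ordIso[of "|Field k|" k] card_of_Field_ordIso[of k]
    by (simp add: card_of_Card_order)
  finally show ?thesis .
qed

lemma SList_subset:
  assumes "regular_cardinal k" "SList V E k" "U \<subseteq> V"
  shows "SList U E k"
  unfolding SList_def
proof (intro allI impI)
  fix L assume L: "\<forall>v\<in>U. L v \<in> stat k"
  define L' where "L' v = (if v \<in> U then L v else Field k)" for v
  have "\<forall>v\<in>V. L' v \<in> stat k" using L Field_in_stat[OF assms(1)] unfolding L'_def by simp
  then obtain c where c: "good V E c" "\<forall>v\<in>V. c v \<in> L' v"
    using assms(2) unfolding SList_def by blast
  have "c v \<in> L v" if "v \<in> U" for v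
    using c(2) that assms(3) unfolding L'_def by (metis subsetD)
  moreover have "good U E c" using c(1) assms(3) unfolding good_def by blast
  ultimately show "\<exists>c. good U E c \<and> (\<forall>v\<in>U. c v \<in> L v)" by blast
qed

text \<open>The order \<open>r\<close> is left arbitrary because the obstruction is used twice: with
  the cardinal well-order of \<open>A\<close> itself, and with \<open>A\<close> inside a regular
  cardinal, where its initial segments have to match guessed sets.\<close>

lemma SList_no_rich_chain:
  fixes k :: "'u rel"
  assumes gch: "GCH TYPE('u)" and k: "regular_cardinal k" and SL: "SList V E k"
    and r: "Well_order r" and A: "A \<subseteq> V" "A \<subseteq> Field r" "|A| =o cardSuc k"
    and small: "\<And>a. a \<in> A \<Longrightarrow> |A \<inter> underS r a| \<le>o k"
    and rich: "\<And>a. a \<in> A \<Longrightarrow> cardSuc k <o |common_nbrs V E (A \<inter> underS r a)|"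
  shows False
proof -
  have Ck: "Cinfinite k" using k unfolding regular_cardinal_def by simp
  have Cs: "Cinfinite (cardSuc k)" using Cinfinite_cardSuc[OF Ck] .
  have AF: "\<not> |A| \<le>o k"
  proof
    assume "|A| \<le>o k"
    then have "cardSuc k \<le>o k" by (rule ordIso_ordLeq_trans[OF ordIso_symmetric[OF A(3)]])
    then show False using cardSuc_greater[of k] Ck not_ordLess_ordLeq by auto
  qed
  have "|stat k| \<le>o |Pow (Field k)|"
    using stat_subset by (intro card_of_mono1) auto
  then have "|stat k| \<le>o cardSuc k"
    by (rule ordLeq_ordIso_trans[OF _ GCH_Pow_Field[OF gch Ck]])
  moreover have "|stat k| \<le>o |A|"
    using calculation by (rule ordLeq_ordIso_trans[OF _ ordIso_symmetric[OF A(3)]])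
  moreover have "stat k \<noteq> {}" using Field_in_stat[OF k] by blast
  \<comment> \<open>Every stationary set becomes the list of some vertex of \<open>A\<close>, as
    there are at most \<open>|A|\<close> of them.\<close>
  ultimately obtain L where L: "L ` A = stat k" using card_of_ordLeq2[of "stat k" A] by blast
  have sizeI: "|A \<times> stat k| \<le>o cardSuc k"
    using Cs A(3) \<open>|stat k| \<le>o cardSuc k\<close>
    by (intro card_of_Times_ordLeq_infinite_Field) (simp_all add: cinfinite_def ordIso_imp_ordLeq)
  \<comment> \<open>Candidates for a vertex joined to the part of \<open>A\<close> below
    \<open>fst p\<close> and carrying the list \<open>snd p\<close>. Leaving out \<open>A\<close>
    removes only \<open>cardSuc k\<close> vertices from a larger set.\<close>
  define W where "W p = common_nbrs V E (A \<inter> underS r (fst p)) - A" for p :: "'u \<times> 'u set"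
  have "cardSuc k \<le>o |W p|" if p: "p \<in> A \<times> stat k" for p
  proof (rule ccontr)
    assume "\<not> cardSuc k \<le>o |W p|"
    then have "|W p| \<le>o cardSuc k"
      using not_ordLeq_card_iff(2)[of "cardSuc k" "W p"] Cs ordLess_imp_ordLeq by auto
    then have "|W p \<union> A| \<le>o cardSuc k"
      using Cs A(3) by (intro Un_Cinfinite_bound) (simp_all add: ordIso_imp_ordLeq)
    then have "|common_nbrs V E (A \<inter> underS r (fst p))| \<le>o cardSuc k"
      by (rule card_of_subset_ordLeq[rotated]) (auto simp: W_def)
    then show False using not_ordLess_ordLeq[OF rich[of "fst p"]] p by auto
  qed
  then obtain f where f: "inj_on f (A \<times> stat k)" "\<And>p. p \<in> A \<times> stat k \<Longrightarrow> f p \<in> W p"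
    using distinct_representatives[OF _ sizeI, of W] Cs by metis
  \<comment> \<open>The representative \<open>f p\<close> receives the list \<open>snd p\<close>,
    which injectivity of \<open>f\<close> makes recoverable.\<close>
  define L' where "L' x = (if x \<in> A then L x else if x \<in> f ` (A \<times> stat k)
    then snd (inv_into (A \<times> stat k) f x) else Field k)" for x
  have "L' x \<in> stat k" for x
  proof -
    have "snd (inv_into (A \<times> stat k) f x) \<in> stat k" if "x \<in> f ` (A \<times> stat k)"
      using inv_into_into[OF that] by (metis mem_Times_iff)
    then show ?thesis using L Field_in_stat[OF k] unfolding L'_def by auto
  qed
  then obtain c where c: "good V E c" "\<And>v. v \<in> V \<Longrightarrow> c v \<in> L' v"
    using SL unfolding SList_def by blast
  have cA: "c a \<in> L a" if "a \<in> A" for a using c(2)[of a] A(1) that unfolding L'_def by auto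
  define R where "R = c ` A"
  have RF: "R \<subseteq> Field k"
    using cA L stat_subset unfolding R_def by blast
  \<comment> \<open>Otherwise the complement of \<open>R\<close> would be stationary and hence the
    list of some vertex of \<open>A\<close>, whose colour would lie outside
    \<open>R\<close>.\<close>
  have "R \<in> stat k"
  proof (rule ccontr)
    assume "R \<notin> stat k"
    then obtain a where a: "a \<in> A" "L a = Field k - R"
      using stat_complement[OF k RF] L by (metis imageE)
    then have "c a \<notin> R" using cA[OF a(1)] by simp
    then show False using a(1) unfolding R_def by blast
  qed
  \<comment> \<open>One vertex of \<open>A\<close> per colour suffices, and there are at most
    \<open>k\<close> colours.\<close>
  define h where "h i = (SOME a. a \<in> A \<and> c a = i)" for i
  have h: "h i \<in> A \<and> c (h i) = i" if "i \<in> R" for i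
    using that someI_ex[of "\<lambda>a. a \<in> A \<and> c a = i"] unfolding h_def R_def by blast
  have "|h ` R| \<le>o k"
    using Ck by (intro ordLeq_transitive[OF card_of_image
      ordLeq_ordIso_trans[OF card_of_mono1[OF RF] card_of_Field_ordIso]]) simp
  \<comment> \<open>Otherwise at most \<open>k\<close> initial segments of size at most
    \<open>k\<close> would cover \<open>A\<close>.\<close>
  have "\<exists>a\<in>A. h ` R \<subseteq> underS r a"
  proof (rule ccontr)
    assume no: "\<not> (\<exists>a\<in>A. h ` R \<subseteq> underS r a)"
    have "A \<subseteq> (\<Union>x\<in>h ` R. insert x (A \<inter> underS r x))"
    proof
      fix a assume a: "a \<in> A"
      then obtain x where x: "x \<in> h ` R" "x \<notin> underS r a" using no by blast
      then have "(a, x) \<in> r" using notin_underS_iff[OF r, of x a] h a A(2) by blast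
      then show "a \<in> (\<Union>x\<in>h ` R. insert x (A \<inter> underS r x))"
        using x(1) a unfolding underS_def by blast
    qed
    moreover have "|\<Union>x\<in>h ` R. insert x (A \<inter> underS r x)| \<le>o k"
    proof (rule UNION_Cinfinite_bound[OF \<open>|h ` R| \<le>o k\<close> _ Ck], rule ballI)
      fix x assume "x \<in> h ` R"
      then have "x \<in> A" using h by blast
      moreover have "|{x}| \<le>o k"
        using Ck by (intro Card_order_singl_ordLeq) (auto simp: cinfinite_def)
      ultimately have "|{x} \<union> (A \<inter> underS r x)| \<le>o k"
        using small[of x] Ck by (intro Un_Cinfinite_bound)
      then show "|insert x (A \<inter> underS r x)| \<le>o k" by simp
    qed
    ultimately have "|A| \<le>o k" by (rule card_of_subset_ordLeq)
    then show False using AF by simp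
  qed
  then obtain a where a: "a \<in> A" "h ` R \<subseteq> underS r a" by blast
  have p: "(a, R) \<in> A \<times> stat k" using a(1) \<open>R \<in> stat k\<close> by blast
  \<comment> \<open>This vertex must take a colour from \<open>R\<close>, and each of these already
    occurs on one of its neighbours.\<close>
  define v where "v = f (a, R)"
  have v: "v \<in> V" "v \<notin> A" "\<And>w. w \<in> A \<inter> underS r a \<Longrightarrow> {v, w} \<in> E"
    using f(2)[OF p] unfolding W_def common_nbrs_def v_def by auto
  have "inv_into (A \<times> stat k) f v = (a, R)"
    using f(1) p unfolding v_def by (rule inv_into_f_f)
  then have "L' v = R" using v(2) p unfolding L'_def v_def by auto
  then have "c v \<in> R" using c(2)[OF v(1)] by simp
  then have hv: "h (c v) \<in> A" "c (h (c v)) = c v" "h (c v) \<in> underS r a"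
    using h a(2) by blast+
  then have "{v, h (c v)} \<in> E" using v(3) by blast
  then show False using c(1) v(1) hv A(1) unfolding good_def by (metis subsetD)
qed

section \<open>Vertices with many neighbours in a small set\<close>

declare Field_card_of [simp] card_of_card_order_on [simp] card_of_Well_order [simp]

section \<open>Power sets and families of small subsets under GCH\<close>

lemma Cinfinite_card_of: "infinite A \<Longrightarrow> Cinfinite |A|"
  by (simp add: cinfinite_def)

text \<open>The power set has the size of the next cardinal after \<open>|Z|\<close>, which is at
  most \<open>l\<close>. Finite \<open>Z\<close> is treated apart because \<open>GCH\<close> speaks
  of infinite sets only.\<close>

lemma card_of_Pow_ordLeq:
  fixes Z :: "'u set"
  assumes gch: "GCH TYPE('u)" and l: "Cinfinite l" and Z: "|Z| <o l"
  shows "|Pow Z| \<le>o l"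
proof (cases "finite Z")
  case True
  then have "Cfinite |Pow Z|"
    by (simp add: cfinite_def)
  then show ?thesis using Cfinite_ordLess_Cinfinite[OF _ l] ordLess_imp_ordLeq by blast
next
  case False
  have "cardSuc |Z| \<le>o l"
    using cardSuc_least[OF card_of_Card_order _ Z] l by simp
  then show ?thesis by (rule ordIso_ordLeq_trans[OF GCH_Pow[OF gch False]])
qed

lemma card_of_Times_ordLess:
  assumes k: "Cinfinite k" and l: "k <o l" "|Y| <o l"
  shows "|Field k \<times> Y| <o l"
proof (cases "|Y| \<le>o k")
  case True
  have "|Field k \<times> Y| \<le>o k"
    using k True card_of_Field_ordIso[of k]
    by (intro card_of_Times_ordLeq_infinite_Field) (simp_all add: cinfinite_def ordIso_imp_ordLeq)
  then show ?thesis by (rule ordLeq_ordLess_trans[OF _ l(1)])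
next
  case False
  then have kY: "k \<le>o |Y|" using not_ordLeq_card_iff(1)[of k Y] k ordLess_imp_ordLeq by blast
  then have "infinite Y" using cinfinite_mono[OF kY] k by (simp add: cinfinite_def)
  then have "|Field k \<times> Y| \<le>o |Y|"
    using kY ordIso_ordLeq_trans[OF card_of_Field_ordIso[of k] kY] k
    by (intro card_of_Times_ordLeq_infinite_Field)
      (simp_all add: ordLeq_refl)
  then show ?thesis by (rule ordLeq_ordLess_trans[OF _ l(2)])
qed

text \<open>
  For successor \<open>l\<close>, the first case fails only if the predecessor of \<open>l\<close> has cofinality at most
  \<open>k\<close>, and then every set of that size is a union of \<open>k\<close> pieces with fewer than \<open>l\<close> subsets.
\<close>

lemma small_subsets_dichotomy:
  fixes k :: "'u rel" and l :: "'c rel"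
  assumes gch: "GCH TYPE('u)" and k: "Cinfinite k" and l: "Cinfinite l" "cardSuc k <o l"
  obtains (few) "\<And>B :: 'u set. |B| <o l \<Longrightarrow> |{K. K \<subseteq> B \<and> |K| \<le>o k}| <o l"
  | (split) K0 :: "'u set" and Y0 :: "'u \<Rightarrow> 'u set" where "|K0| \<le>o k"
    "\<And>x Z :: 'u set. x \<in> K0 \<Longrightarrow> |Z| \<le>o |Field k \<times> Y0 x| \<Longrightarrow> |Pow Z| <o l"
    "\<And>D :: 'u set. |D| <o l \<Longrightarrow> \<exists>Y. D = (\<Union>x\<in>K0. Y x) \<and> (\<forall>x\<in>K0. |Y x| \<le>o |Y0 x| )"
proof (cases "\<forall>B :: 'u set. |B| <o l \<longrightarrow> |{K. K \<subseteq> B \<and> |K| \<le>o k}| <o l")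
  case True
  then show thesis using few by blast
next
  case False
  then obtain B :: "'u set" where B: "|B| <o l" "\<not> |{K. K \<subseteq> B \<and> |K| \<le>o k}| <o l" by blast
  define S where "S = {K. K \<subseteq> B \<and> |K| \<le>o k}"
  have "l \<le>o |S|"
    using B(2) l(1) not_ordLeq_card_iff(2)[of l S] unfolding S_def by blast
  moreover have "|S| \<le>o |Pow B|" unfolding S_def by (intro card_of_mono1) blast
  \<comment> \<open>Together with \<open>|B| <o l\<close> and GCH this makes \<open>l\<close> the
    successor of \<open>|B|\<close>, once \<open>B\<close> is known to be infinite.\<close>
  ultimately have lB: "l \<le>o |Pow B|" by (rule ordLeq_transitive)
  have kB: "k <o |B|"
  proof (rule ccontr)
    assume "\<not> k <o |B|"
    then have "|B| \<le>o k" using not_ordLeq_card_iff(1)[of k B] k by blast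
    then have "|B| <o cardSuc k"
      using k by (intro ordLeq_ordLess_trans[OF _ cardSuc_greater]) simp_all
    then have "|Pow B| \<le>o cardSuc k"
      using Cinfinite_cardSuc[OF k] by (intro card_of_Pow_ordLeq[OF gch])
    then have "l \<le>o cardSuc k" by (rule ordLeq_transitive[OF lB])
    then show False using not_ordLess_ordLeq[OF l(2)] by simp
  qed
  have infB: "infinite B"
    using cinfinite_mono[OF ordLess_imp_ordLeq[OF kB]] k by (simp add: cinfinite_def)
  have CB: "Cinfinite |B|" using infB by (rule Cinfinite_card_of)
  \<comment> \<open>Power sets of proper initial segments contribute only \<open>|B|\<close> sets,
    too few for \<open>S\<close>. So some set of size at most \<open>k\<close> is unbounded in
    \<open>|B|\<close>.\<close>
  have "\<exists>K\<in>S. \<forall>x\<in>B. \<not> K \<subseteq> underS |B| x"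
  proof (rule ccontr)
    assume "\<not> ?thesis"
    then have "S \<subseteq> (\<Union>x\<in>B. Pow (underS |B| x))" by blast
    moreover have "|\<Union>x\<in>B. Pow (underS |B| x)| \<le>o |B|"
    proof (rule UNION_Cinfinite_bound[OF _ _ CB], rule card_of_mono1[OF subset_refl], rule ballI)
      fix x assume "x \<in> B"
      then have "|underS |B| x| <o |B|"
        by (intro card_of_underS) simp_all
      then show "|Pow (underS |B| x)| \<le>o |B|" by (rule card_of_Pow_ordLeq[OF gch CB])
    qed
    ultimately have "|S| \<le>o |B|" by (rule card_of_subset_ordLeq)
    then show False using ordLeq_ordLess_trans[OF _ B(1)] B(2) unfolding S_def by blast
  qed
  then obtain K0 where K0: "K0 \<subseteq> B" "|K0| \<le>o k" "\<And>x. x \<in> B \<Longrightarrow> \<not> K0 \<subseteq> underS |B| x"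
    unfolding S_def by blast
  have cover: "b \<in> (\<Union>x\<in>K0. under |B| x)" if b: "b \<in> B" for b
  proof -
    obtain x where x: "x \<in> K0" "x \<notin> underS |B| b" using K0(3)[OF b] by blast
    then have "(b, x) \<in> |B|"
      using notin_underS_iff[OF card_of_Well_order, of x B b] K0(1) b by auto
    then show ?thesis using x(1) unfolding under_def by blast
  qed
  show thesis
  \<comment> \<open>The pieces are the closed initial segments at points of the unbounded set
    \<open>K0\<close>. They are smaller than \<open>|B|\<close>, even after multiplication by
    \<open>k\<close>, so their power sets have size at most \<open>|B|\<close>.\<close>
  proof (rule split[of K0 "under |B|"])
    fix x and Z :: "'u set" assume x: "x \<in> K0" and Z: "|Z| \<le>o |Field k \<times> under |B| x|"
    have "|under |B| x| <o |B|"
      using x K0(1) by (intro card_of_under[OF CB]) auto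
    then have "|Z| <o |B|"
      by (intro ordLeq_ordLess_trans[OF Z] card_of_Times_ordLess[OF k kB])
    then have "|Pow Z| \<le>o |B|" by (rule card_of_Pow_ordLeq[OF gch CB])
    then show "|Pow Z| <o l" by (rule ordLeq_ordLess_trans[OF _ B(1)])
  next
    fix D :: "'u set" assume "|D| <o l"
    then have "|D| <o cardSuc |B|"
      by (rule ordLess_ordLeq_trans[OF _ ordLeq_ordIso_trans[OF lB GCH_Pow[OF gch infB]]])
    then have "|D| \<le>o |B|"
      using cardSuc_ordLeq_ordLess[of "|B|" "|D|"] by simp
    \<comment> \<open>An arbitrary \<open>D\<close> inherits the pieces of \<open>B\<close> through
      an injection.\<close>
    then obtain f where f: "inj_on f D" "f ` D \<subseteq> B" using card_of_ordLeq[of D B] by blast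
    define Y where "Y x = {d\<in>D. f d \<in> under |B| x}" for x
    have "D = (\<Union>x\<in>K0. Y x)" using f(2) cover unfolding Y_def by blast
    moreover have "|Y x| \<le>o |under |B| x|" for x
      using f(1) unfolding Y_def by (intro card_of_ordLeqI[of f]) (auto intro: inj_on_subset)
    ultimately show "\<exists>Y. D = (\<Union>x\<in>K0. Y x) \<and> (\<forall>x\<in>K0. |Y x| \<le>o |under |B| x| )" by blast
  qed (rule K0(2))
qed

text \<open>If the small subsets of \<open>B\<close> are few, they form \<open>G\<close>. Otherwise
  \<open>B\<close> splits into at most \<open>k\<close> pieces, one of which meets \<open>A\<close>
  in a large set, and \<open>G\<close> consists of all subsets of single pieces.\<close>

lemma small_guessing_family:
  fixes k :: "'u rel" and l :: "'c rel"
  assumes gch: "GCH TYPE('u)" and k: "Cinfinite k"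
    and l: "Cinfinite l" "regularCard l" "cardSuc k <o l" and B: "|B :: 'u set| <o l"
  obtains G where "|G| <o l" "\<And>A. A \<subseteq> B \<Longrightarrow> cardSuc k \<le>o |A| \<Longrightarrow>
    \<exists>A'\<subseteq>A. cardSuc k \<le>o |A'| \<and> (\<forall>K\<subseteq>A'. |K| \<le>o k \<longrightarrow> K \<in> G)"
  using gch k l(1,3)
proof (cases rule: small_subsets_dichotomy)
  case few
  show thesis
  proof (rule that[OF few[OF B]])
    fix A assume "A \<subseteq> B" "cardSuc k \<le>o |A|"
    then show "\<exists>A'\<subseteq>A. cardSuc k \<le>o |A'| \<and> (\<forall>K\<subseteq>A'. |K| \<le>o k \<longrightarrow> K \<in> {K. K \<subseteq> B \<and> |K| \<le>o k})"
      by (intro exI[of _ A]) auto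
  qed
next
  case (split K0 Y0)
  obtain Y where Y: "B = (\<Union>x\<in>K0. Y x)" "\<And>x. x \<in> K0 \<Longrightarrow> |Y x| \<le>o |Y0 x|"
    using split(3)[OF B] by blast
  have kl: "k <o l"
    using k by (intro ordLess_transitive[OF cardSuc_greater l(3)]) simp
  have "|\<Union>x\<in>K0. Pow (Y x)| <o l"
  proof (rule card_of_UNION_ordLess_infinite_Field_regularCard[OF l(2,1)], rule ordLeq_ordLess_trans[OF split(1) kl], rule ballI)
    fix x assume x: "x \<in> K0"
    have "|Y x| \<le>o |Field k \<times> Y0 x|"
      using k by (intro ordLeq_transitive[OF Y(2)[OF x] card_of_Times2]) (auto simp: cinfinite_def)
    then show "|Pow (Y x)| <o l" by (rule split(2)[OF x])
  qed
  then show thesis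
  proof (rule that)
    fix A assume A: "A \<subseteq> B" "cardSuc k \<le>o |A|"
    obtain x where "x \<in> K0" "cardSuc k \<le>o |A \<inter> Y x|"
      using pigeonhole_cardSuc[OF k split(1), of A Y] A Y(1) by blast
    then show "\<exists>A'\<subseteq>A. cardSuc k \<le>o |A'| \<and> (\<forall>K\<subseteq>A'. |K| \<le>o k \<longrightarrow> K \<in> (\<Union>x\<in>K0. Pow (Y x)))"
      by (intro exI[of _ "A \<inter> Y x"]) auto
  qed
qed

text \<open>A neighbourhood that is large in \<open>B\<close> contains a large set all of whose
  small subsets lie in \<open>G\<close>. By the obstruction one of its initial segments has at most
  \<open>cardSuc k\<close> common neighbours, and the vertex is among them. Fewer than
  \<open>l\<close> such segments account for fewer than \<open>l\<close> vertices, as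
  \<open>l\<close> is regular.\<close>

lemma few_vertices_with_many_nbrs:
  fixes k :: "'u rel" and l :: "'c rel"
  assumes gch: "GCH TYPE('u)" and k: "regular_cardinal k" and SL: "SList V E k"
    and l: "Cinfinite l" "regularCard l" "cardSuc k <o l" and B: "B \<subseteq> V" "|B| <o l"
  shows "|{v\<in>V. cardSuc k \<le>o |nbrs_in E v B| }| <o l"
proof -
  have Ck: "Cinfinite k" and Cs: "Cinfinite (cardSuc k)"
    using regular_cardinalD(1)[OF k] Cinfinite_cardSuc by auto
  obtain G where G: "|G| <o l" "\<And>A. A \<subseteq> B \<Longrightarrow> cardSuc k \<le>o |A| \<Longrightarrow>
    \<exists>A'\<subseteq>A. cardSuc k \<le>o |A'| \<and> (\<forall>K\<subseteq>A'. |K| \<le>o k \<longrightarrow> K \<in> G)"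
    using small_guessing_family[OF gch Ck l B(2)] by blast
  define G' where "G' = {K\<in>G. |common_nbrs V E K| \<le>o cardSuc k}"
  have "{v\<in>V. cardSuc k \<le>o |nbrs_in E v B| } \<subseteq> (\<Union>K\<in>G'. common_nbrs V E K)"
  proof
    fix v assume v: "v \<in> {v\<in>V. cardSuc k \<le>o |nbrs_in E v B| }"
    have "nbrs_in E v B \<subseteq> B" unfolding nbrs_in_def by blast
    then obtain A' where A': "A' \<subseteq> nbrs_in E v B" "cardSuc k \<le>o |A'|"
      "\<And>K. K \<subseteq> A' \<Longrightarrow> |K| \<le>o k \<Longrightarrow> K \<in> G" using G(2)[of "nbrs_in E v B"] v by blast
    obtain A where A: "A \<subseteq> A'" "|A| =o cardSuc k"
      using subset_of_card[OF _ A'(2)] Cs by blast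
    have small: "|A \<inter> underS |A| a| \<le>o k" if "a \<in> A" for a
    proof -
      have "|underS |A| a| <o |A|"
        using that by (intro card_of_underS) simp_all
      then have "|underS |A| a| <o cardSuc k" by (rule ordLess_ordIso_trans[OF _ A(2)])
      then have "|A \<inter> underS |A| a| <o cardSuc k" by (rule card_of_subset_ordLess[rotated]) simp
      then show ?thesis
        using cardSuc_ordLeq_ordLess[of k "|A \<inter> underS |A| a|"] Ck by simp
    qed
    have "A \<subseteq> V" using A(1) A'(1) B(1) unfolding nbrs_in_def by blast
    then have "\<not> (\<forall>a\<in>A. cardSuc k <o |common_nbrs V E (A \<inter> underS |A| a)| )"
      using SList_no_rich_chain[OF gch k SL card_of_Well_order, of A A] small A(2)
      by auto
    then obtain a where a: "a \<in> A" "\<not> cardSuc k <o |common_nbrs V E (A \<inter> underS |A| a)|" by blast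
    let ?K = "A \<inter> underS |A| a"
    have "|common_nbrs V E ?K| \<le>o cardSuc k"
      using a(2) not_ordLeq_card_iff(1)[of "cardSuc k"] Cs by blast
    moreover have "?K \<in> G" using A'(3)[of ?K] small[OF a(1)] A(1) by blast
    moreover have "v \<in> common_nbrs V E ?K"
      using v A(1) A'(1) unfolding common_nbrs_def nbrs_in_def by blast
    ultimately show "v \<in> (\<Union>K\<in>G'. common_nbrs V E K)" unfolding G'_def by blast
  qed
  moreover have "|\<Union>K\<in>G'. common_nbrs V E K| <o l"
  proof (rule card_of_UNION_ordLess_infinite_Field_regularCard[OF l(2,1)])
    show "|G'| <o l" by (rule card_of_subset_ordLess[OF _ G(1)]) (auto simp: G'_def)
    show "\<forall>K\<in>G'. |common_nbrs V E K| <o l"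
      using ordLeq_ordLess_trans[OF _ l(3)] unfolding G'_def by blast
  qed
  ultimately show ?thesis by (rule card_of_subset_ordLess)
qed

section \<open>Approachability\<close>

text \<open>The set \<open>A\<close> is cofinal in \<open>\<gamma>\<close>, so \<open>c\<close>,
  whose order type is the cofinality, embeds into \<open>A\<close> as an initial segment. Initial
  segments of \<open>c\<close> thereby inherit the bound on those of \<open>A\<close>.\<close>

lemma card_of_below_approaching:
  assumes k: "Well_order m" and \<gamma>: "limit_in m \<gamma>"
    and A: "A \<subseteq> underS m \<gamma>" "\<not> |A| \<le>o s" "\<And>\<beta>. \<beta> \<in> underS m \<gamma> \<Longrightarrow> |A \<inter> underS m \<beta>| \<le>o s"
    and c: "cofinal_below m \<gamma> c" "Restr m c =o cf m \<gamma>" and \<delta>: "\<delta> \<in> underS m \<gamma>"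
  shows "|c \<inter> underS m \<delta>| \<le>o s"
proof -
  have sub: "d \<subseteq> Field m" if "d \<subseteq> underS m \<gamma>" for d
    using that underS_in_Field[of _ m \<gamma>] by blast
  have Refl: "Refl m" using k wo_rel.REFL[of m] by (simp add: wo_rel_def)
  \<comment> \<open>A bound below \<open>\<gamma>\<close> would turn \<open>A\<close> into one of
    its own small initial segments.\<close>
  have cofA: "cofinal_below m \<gamma> A"
  proof (rule ccontr)
    assume "\<not> cofinal_below m \<gamma> A"
    then obtain \<alpha> where \<alpha>: "\<alpha> \<in> underS m \<gamma>" "\<And>\<beta>. \<beta> \<in> A \<Longrightarrow> (\<alpha>, \<beta>) \<notin> m"
      using A(1) unfolding cofinal_below_def by blast
    have "A \<inter> underS m \<alpha> = A"
      using notin_underS_iff[OF k, of _ \<alpha>] \<alpha>(2) sub[OF A(1)] underS_in_Field[OF \<alpha>(1)] by blast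
    then show False using A(2) A(3)[OF \<alpha>(1)] by simp
  qed
  \<comment> \<open>Well-orders are well-founded under comparison, so the choice in
    \<open>cf\<close> does return a cofinal set of least order type.\<close>
  define R where "R = {Restr m d | d. cofinal_below m \<gamma> d}"
  have "R \<noteq> {}" "\<forall>q\<in>R. Well_order q"
    using cofA Well_order_Restr[OF k] unfolding R_def by auto
  then obtain q where "q \<in> R" "\<forall>q'\<in>R. q \<le>o q'"
    using exists_minim_Well_order[of R] by blast
  then have "\<exists>c. cofinal_below m \<gamma> c \<and> (\<forall>d. cofinal_below m \<gamma> d \<longrightarrow> Restr m c \<le>o Restr m d)"
    unfolding R_def by blast
  from someI_ex[OF this] have "cf m \<gamma> \<le>o Restr m A"
    using cofA unfolding cf_def by blast
  then have "Restr m c \<le>o Restr m A" by (rule ordIso_ordLeq_trans[OF c(2)])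
  then obtain f where f: "embed (Restr m c) (Restr m A) f" unfolding ordLeq_def by blast
  have cF: "Field (Restr m c) = c" "Field (Restr m A) = A"
    using Refl_Field_Restr2[OF Refl sub] c(1) A(1) unfolding cofinal_below_def by auto
  obtain e where e: "e \<in> c" "(\<delta>, e) \<in> m" using c(1) \<delta> unfolding cofinal_below_def by blast
  have bij: "bij_betw f (under (Restr m c) e) (under (Restr m A) (f e))"
    using f e(1) cF(1) unfolding embed_def by simp
  have "e \<in> under (Restr m c) e"
    using e(1) Refl sub[of c] c(1) unfolding under_def refl_on_def cofinal_below_def by blast
  then have "f e \<in> under (Restr m A) (f e)" using bij_betwE[OF bij] by blast
  then have "f e \<in> underS m \<gamma>" using A(1) unfolding under_def by blast
  then obtain \<beta> where \<beta>: "\<beta> \<in> underS m \<gamma>" "f e \<in> underS m \<beta>" using \<gamma> unfolding limit_in_def by blast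
  have "under (Restr m A) (f e) \<subseteq> A \<inter> underS m \<beta>"
    using underS_trans2[OF k _ \<beta>(2)] unfolding under_def by blast
  then have "|under (Restr m A) (f e)| \<le>o s"
    by (rule card_of_subset_ordLeq[OF _ A(3)[OF \<beta>(1)]])
  then have "|under (Restr m c) e| \<le>o s"
    by (rule ordIso_ordLeq_trans[OF card_of_ordIsoI[OF bij]])
  moreover have "c \<inter> underS m \<delta> \<subseteq> under (Restr m c) e"
    using underS_imp_le[OF underS_trans[OF k _ e(2)]] e(1) unfolding under_def by blast
  ultimately show ?thesis by (rule card_of_subset_ordLeq[rotated])
qed

text \<open>
  In the second case of the dichotomy the approaching set \<open>c\<close> assigns to each \<open>a \<in> A\<close> the least
  \<open>d a \<in> c\<close> above it; by the pigeonhole principle many \<open>a\<close> lie in the same piece \<open>x\<close> of their \<open>d a\<close>.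
  The part of these below \<open>\<beta>\<close> is covered by the pieces \<open>x\<close> along an initial segment of \<open>c\<close>,
  which is some \<open>b \<eta>\<close> with \<open>\<eta>\<close> below \<open>\<gamma>\<close>.
\<close>

lemma approachable_guessing:
  fixes k m :: "'u rel"
  assumes gch: "GCH TYPE('u)" and k: "Cinfinite k" and m: "regular_cardinal m" "cardSuc k <o m"
    and ap: "Field m \<in> I[m]"
  shows "\<exists>C G. club m C \<and> (\<forall>\<eta>\<in>Field m. |G \<eta>| <o m) \<and>
    (\<forall>\<eta> K K'. K \<in> G \<eta> \<longrightarrow> K' \<subseteq> K \<longrightarrow> K' \<in> G \<eta>) \<and>
    (\<forall>\<gamma> A. \<gamma> \<in> C \<longrightarrow> limit_in m \<gamma> \<longrightarrow> A \<subseteq> underS m \<gamma> \<longrightarrow> cardSuc k \<le>o |A| \<longrightarrow>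
      (\<forall>\<beta>\<in>underS m \<gamma>. |A \<inter> underS m \<beta>| \<le>o k) \<longrightarrow>
      (\<exists>A'\<subseteq>A. cardSuc k \<le>o |A'| \<and> (\<forall>\<beta>\<in>underS m \<gamma>. \<exists>\<eta>\<in>underS m \<gamma>. A' \<inter> underS m \<beta> \<in> G \<eta>)))"
    (is "\<exists>C G. ?P C G")
proof -
  note mD = regular_cardinalD[OF m(1)]
  have wo: "Well_order m" using m(1) by (rule regular_cardinal_wo)
  have Cs: "Cinfinite (cardSuc k)" using Cinfinite_cardSuc[OF k] .
  have km: "k <o m"
    using k by (intro ordLess_transitive[OF cardSuc_greater m(2)]) simp
  have under_less: "|underS m \<eta>| <o m" if "\<eta> \<in> Field m" for \<eta>
    using card_of_underS[OF mD(3) that] .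
  have "\<exists>(b :: 'u \<Rightarrow> 'u set) C. (\<forall>\<xi>\<in>Field m. bounded_in m (b \<xi>)) \<and> club m C \<and>
      (\<forall>\<gamma>\<in>C \<inter> Field m. \<exists>c. cofinal_below m \<gamma> c \<and> Restr m c =o cf m \<gamma> \<and>
        (\<forall>\<delta>\<in>underS m \<gamma>. \<exists>\<eta>\<in>underS m \<gamma>. c \<inter> underS m \<delta> = b \<eta>))"
    using ap unfolding approachability_ideal_def mem_Collect_eq by (rule conjunct2)
  then obtain b C where bC: "\<forall>\<xi>\<in>Field m. bounded_in m (b \<xi>)" and C: "club m C"
    and appr': "\<forall>\<gamma>\<in>C \<inter> Field m. \<exists>c. cofinal_below m \<gamma> c \<and> Restr m c =o cf m \<gamma> \<and>
      (\<forall>\<delta>\<in>underS m \<gamma>. \<exists>\<eta>\<in>underS m \<gamma>. c \<inter> underS m \<delta> = b \<eta>)"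
    by (elim exE conjE, intro that)
  note b = bspec[OF bC] and appr = bspec[OF appr']
  \<comment> \<open>In both cases the club is the one given by approachability; only
    \<open>G\<close> differs.\<close>
  have witness: "\<exists>C G. ?P C G"
    if "\<And>\<eta>. \<eta> \<in> Field m \<Longrightarrow> |G \<eta>| <o m"
      "\<And>\<eta> K K'. K \<in> G \<eta> \<Longrightarrow> K' \<subseteq> K \<Longrightarrow> K' \<in> G \<eta>"
      "\<And>\<gamma> A. \<gamma> \<in> C \<Longrightarrow> limit_in m \<gamma> \<Longrightarrow> A \<subseteq> underS m \<gamma> \<Longrightarrow> cardSuc k \<le>o |A| \<Longrightarrow>
        (\<And>\<beta>. \<beta> \<in> underS m \<gamma> \<Longrightarrow> |A \<inter> underS m \<beta>| \<le>o k) \<Longrightarrow>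
        \<exists>A'\<subseteq>A. cardSuc k \<le>o |A'| \<and> (\<forall>\<beta>\<in>underS m \<gamma>. \<exists>\<eta>\<in>underS m \<gamma>. A' \<inter> underS m \<beta> \<in> G \<eta>)"
    for G
  proof (rule exI[of _ C], rule exI[of _ G], intro conjI allI ballI impI)
    show "club m C" by (rule C)
    show "|G \<eta>| <o m" if "\<eta> \<in> Field m" for \<eta> using that by (rule \<open>\<And>\<eta>. \<eta> \<in> Field m \<Longrightarrow> |G \<eta>| <o m\<close>)
  qed (use that(2,3) in \<open>simp_all\<close>)
  from gch k mD(1) m(2) show ?thesis
  proof (cases rule: small_subsets_dichotomy)
    case few
    show ?thesis
    proof (rule witness[of "\<lambda>\<eta>. {K. K \<subseteq> underS m \<eta> \<and> |K| \<le>o k}"])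
      fix \<eta> assume "\<eta> \<in> Field m"
      then show "|{K. K \<subseteq> underS m \<eta> \<and> |K| \<le>o k}| <o m" by (intro few under_less)
    next
      fix \<eta> K K' assume "K \<in> {K. K \<subseteq> underS m \<eta> \<and> |K| \<le>o k}" "K' \<subseteq> K"
      then show "K' \<in> {K. K \<subseteq> underS m \<eta> \<and> |K| \<le>o k}"
        using card_of_subset_ordLeq[of K' K k] by auto
    next
      fix \<gamma> A assume A: "A \<subseteq> underS m \<gamma>" "cardSuc k \<le>o |A|"
        "\<And>\<beta>. \<beta> \<in> underS m \<gamma> \<Longrightarrow> |A \<inter> underS m \<beta>| \<le>o k"
      have "\<forall>\<beta>\<in>underS m \<gamma>. A \<inter> underS m \<beta> \<in> {K. K \<subseteq> underS m \<beta> \<and> |K| \<le>o k}"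
        using A(3) by simp
      then show "\<exists>A'\<subseteq>A. cardSuc k \<le>o |A'| \<and>
        (\<forall>\<beta>\<in>underS m \<gamma>. \<exists>\<eta>\<in>underS m \<gamma>. A' \<inter> underS m \<beta> \<in> {K. K \<subseteq> underS m \<eta> \<and> |K| \<le>o k})"
        using A(2) by blast
    qed
  next
    case (split K0 Y0)
    have "\<forall>\<delta>\<in>Field m. \<exists>Y. underS m \<delta> = (\<Union>x\<in>K0. Y x) \<and> (\<forall>x\<in>K0. |Y x| \<le>o |Y0 x| )"
      by (rule ballI) (rule split(3)[OF under_less])
    from bchoice[OF this] obtain Y where
      Y': "\<forall>\<delta>\<in>Field m. underS m \<delta> = (\<Union>x\<in>K0. Y \<delta> x) \<and> (\<forall>x\<in>K0. |Y \<delta> x| \<le>o |Y0 x| )"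
      by (rule exE)
    have Y: "underS m \<delta> = (\<Union>x\<in>K0. Y \<delta> x)" "x \<in> K0 \<Longrightarrow> |Y \<delta> x| \<le>o |Y0 x|"
      if "\<delta> \<in> Field m" for \<delta> x
      using bspec[OF Y' that] by simp_all
    \<comment> \<open>The guard keeps \<open>G \<eta>\<close> small also when
      \<open>b \<eta>\<close> is too large to be an initial segment of a relevant
      \<open>c\<close>.\<close>
    define G where "G \<eta> = (if |b \<eta>| \<le>o k then \<Union>x\<in>K0. Pow (\<Union>\<delta>\<in>b \<eta>. Y \<delta> x) else {})" for \<eta>
    show ?thesis
    proof (rule witness[of G])
      fix \<eta> assume \<eta>: "\<eta> \<in> Field m"
      show "|G \<eta>| <o m"
      proof (cases "|b \<eta>| \<le>o k")
        case True
        have "|\<Union>x\<in>K0. Pow (\<Union>\<delta>\<in>b \<eta>. Y \<delta> x)| <o m"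
        proof (rule card_of_UNION_ordLess_infinite_Field_regularCard[OF mD(2,1)],
            rule ordLeq_ordLess_trans[OF split(1) km], rule ballI)
          fix x assume x: "x \<in> K0"
          have "|b \<eta>| \<le>o |Field k|"
            using k by (intro ordLeq_ordIso_trans[OF True ordIso_symmetric[OF card_of_Field_ordIso]]) simp
          then have bk: "|b \<eta> \<times> Y0 x| \<le>o |Field k \<times> Y0 x|" by (rule card_of_Times_mono1)
          have "|\<Union>\<delta>\<in>b \<eta>. Y \<delta> x| \<le>o |SIGMA \<delta>:b \<eta>. Y \<delta> x|" by (rule card_of_UNION_Sigma)
          moreover have "|SIGMA \<delta>:b \<eta>. Y \<delta> x| \<le>o |b \<eta> \<times> Y0 x|"
            using b[OF \<eta>] Y(2)[OF _ x] unfolding bounded_in_def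
            by (intro card_of_Sigma_mono1) auto
          ultimately have "|\<Union>\<delta>\<in>b \<eta>. Y \<delta> x| \<le>o |Field k \<times> Y0 x|"
            using bk by (metis ordLeq_transitive)
          then show "|Pow (\<Union>\<delta>\<in>b \<eta>. Y \<delta> x)| <o m" by (rule split(2)[OF x])
        qed
        then show ?thesis using True unfolding G_def by simp
      next
        case False
        then have G0: "G \<eta> = {}" unfolding G_def by simp
        have "Cfinite |G \<eta>|" unfolding G0 by (simp add: cfinite_def)
        then show ?thesis by (rule Cfinite_ordLess_Cinfinite[OF _ mD(1)])
      qed
    next
      fix \<eta> K K' assume "K \<in> G \<eta>" "K' \<subseteq> K"
      then show "K' \<in> G \<eta>" unfolding G_def by (auto split: if_splits)
    next
      fix \<gamma> A assume \<gamma>: "\<gamma> \<in> C" "limit_in m \<gamma>" and A: "A \<subseteq> underS m \<gamma>" "cardSuc k \<le>o |A|"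
        "\<And>\<beta>. \<beta> \<in> underS m \<gamma> \<Longrightarrow> |A \<inter> underS m \<beta>| \<le>o k"
      have "\<gamma> \<in> C \<inter> Field m" using \<gamma> unfolding limit_in_def by simp
      from appr[OF this] obtain c where c: "cofinal_below m \<gamma> c" "Restr m c =o cf m \<gamma>"
        "\<And>\<delta>. \<delta> \<in> underS m \<gamma> \<Longrightarrow> \<exists>\<eta>\<in>underS m \<gamma>. c \<inter> underS m \<delta> = b \<eta>" by blast
      have cF: "c \<subseteq> underS m \<gamma>" using c(1) unfolding cofinal_below_def by simp
      have "\<not> |A| \<le>o k" using A(2) not_cardSuc_ordLeq_iff[of k A] k by blast
      then have c_small: "|c \<inter> underS m \<delta>| \<le>o k" if "\<delta> \<in> underS m \<gamma>" for \<delta>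
        using card_of_below_approaching[OF wo \<gamma>(2) A(1) _ A(3) c(1,2) that] by simp
      have above: "\<exists>e\<in>c. \<beta> \<in> underS m e" if \<beta>: "\<beta> \<in> underS m \<gamma>" for \<beta>
      proof -
        obtain \<beta>' where "\<beta>' \<in> underS m \<gamma>" "\<beta> \<in> underS m \<beta>'" using \<gamma>(2) \<beta> unfolding limit_in_def by blast
        then show ?thesis using c(1) underS_trans[OF wo] unfolding cofinal_below_def by blast
      qed
      define d where "d a = wo_rel.minim m {e\<in>c. a \<in> underS m e}" for a
      have d: "d a \<in> c" "a \<in> underS m (d a)" "\<And>e. e \<in> c \<Longrightarrow> a \<in> underS m e \<Longrightarrow> (d a, e) \<in> m"
        if "a \<in> A" for a
      proof -
        have ne: "{e\<in>c. a \<in> underS m e} \<noteq> {}" "{e\<in>c. a \<in> underS m e} \<subseteq> Field m"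
          using above[of a] that A(1) cF underS_in_Field[of _ m \<gamma>] by blast+
        have wr: "wo_rel m" using wo by (simp add: wo_rel_def)
        show "d a \<in> c" "a \<in> underS m (d a)"
          using wo_rel.minim_in[OF wr ne(2,1)] unfolding d_def by auto
        show "(d a, e) \<in> m" if "e \<in> c" "a \<in> underS m e" for e
          using wo_rel.minim_least[OF wr ne(2), of e] that unfolding d_def by simp
      qed
      have "A \<subseteq> (\<Union>x\<in>K0. {a. a \<in> Y (d a) x})"
      proof
        fix a assume a: "a \<in> A"
        have "d a \<in> Field m" using d(1)[OF a] cF underS_in_Field[of _ m \<gamma>] by blast
        then show "a \<in> (\<Union>x\<in>K0. {a. a \<in> Y (d a) x})" using d(2)[OF a] Y(1)[of "d a"] by auto
      qed
      from pigeonhole_cardSuc[OF k split(1) this A(2)]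
      obtain x where x: "x \<in> K0" "cardSuc k \<le>o |A \<inter> {a. a \<in> Y (d a) x}|" by blast
      define A' where "A' = A \<inter> {a. a \<in> Y (d a) x}"
      have "\<exists>\<eta>\<in>underS m \<gamma>. A' \<inter> underS m \<beta> \<in> G \<eta>" if \<beta>: "\<beta> \<in> underS m \<gamma>" for \<beta>
      proof -
        obtain e where e: "e \<in> c" "\<beta> \<in> underS m e" using above[OF \<beta>] by blast
        \<comment> \<open>Going past \<open>e\<close> puts \<open>e\<close> itself, and every
          \<open>d a\<close> up to \<open>e\<close>, into the segment
          \<open>b \<eta>\<close>.\<close>
        obtain \<beta>' where \<beta>': "\<beta>' \<in> underS m \<gamma>" "e \<in> underS m \<beta>'"
          using \<gamma>(2) e(1) cF unfolding limit_in_def by blast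
        obtain \<eta> where \<eta>: "\<eta> \<in> underS m \<gamma>" "c \<inter> underS m \<beta>' = b \<eta>" using c(3)[OF \<beta>'(1)] by blast
        have "A' \<inter> underS m \<beta> \<subseteq> (\<Union>\<delta>\<in>b \<eta>. Y \<delta> x)"
        proof
          fix a assume a: "a \<in> A' \<inter> underS m \<beta>"
          then have aA: "a \<in> A" "a \<in> Y (d a) x" unfolding A'_def by auto
          have "a \<in> underS m e" using underS_underS[OF wo _ e(2)] a by blast
          then have "(d a, e) \<in> m" using d(3)[OF aA(1) e(1)] by simp
          then have "d a \<in> underS m \<beta>'" using \<beta>'(2) by (rule underS_trans2[OF wo])
          then have "d a \<in> b \<eta>" using \<eta>(2) d(1)[OF aA(1)] by blast
          then show "a \<in> (\<Union>\<delta>\<in>b \<eta>. Y \<delta> x)" using aA(2) by blast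
        qed
        moreover have "|b \<eta>| \<le>o k" using c_small[OF \<beta>'(1)] \<eta>(2) by simp
        ultimately have "A' \<inter> underS m \<beta> \<in> G \<eta>" using x(1) unfolding G_def by auto
        then show ?thesis using \<eta>(1) by blast
      qed
      then show "\<exists>A'\<subseteq>A. cardSuc k \<le>o |A'| \<and> (\<forall>\<beta>\<in>underS m \<gamma>. \<exists>\<eta>\<in>underS m \<gamma>. A' \<inter> underS m \<beta> \<in> G \<eta>)"
        using x(2) unfolding A'_def by (intro exI[of _ "A \<inter> {a. a \<in> Y (d a) x}"]) auto
    qed
  qed
qed

text \<open>If \<open>v\<close> is not below \<open>\<gamma>\<close> and has too many neighbours
  there, these contain a set whose initial segments lie in families \<open>G \<eta>\<close> with
  \<open>\<eta>\<close> below \<open>\<gamma>\<close>. When \<open>\<gamma>\<close> already contains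
  all exceptional vertices produced below it, each of these segments has more than
  \<open>cardSuc k\<close> common neighbours, contradicting the obstruction.\<close>

lemma club_of_closed_segments:
  fixes k m :: "'u rel"
  assumes gch: "GCH TYPE('u)" and k: "regular_cardinal k" and SL: "SList (Field m) E k"
    and m: "regular_cardinal m" "cardSuc k <o m" and ap: "Field m \<in> I[m]"
  obtains D where "club m D" "\<And>\<gamma> v. \<gamma> \<in> D \<Longrightarrow> v \<in> Field m - underS m \<gamma> \<Longrightarrow>
    |nbrs_in E v (underS m \<gamma>)| \<le>o k"
proof -
  note mD = regular_cardinalD[OF m(1)]
  have wo: "Well_order m" using m(1) by (rule regular_cardinal_wo)
  have Ck: "Cinfinite k" and Cs: "Cinfinite (cardSuc k)"
    using regular_cardinalD(1)[OF k] Cinfinite_cardSuc by auto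
  have m_unc: "\<not> m =o natLeq"
  proof
    assume "m =o natLeq"
    then have "cardSuc k <o natLeq" by (rule ordLess_ordIso_trans[OF m(2)])
    then show False using not_ordLess_ordLeq natLeq_ordLeq_cinfinite[OF Cs] by metis
  qed
  obtain C G where C: "club m C" and G': "\<forall>\<eta>\<in>Field m. |G \<eta>| <o m"
    and G_down': "\<forall>\<eta> K K'. K \<in> G \<eta> \<longrightarrow> K' \<subseteq> K \<longrightarrow> K' \<in> G \<eta>"
    and guess: "\<forall>\<gamma> A. \<gamma> \<in> C \<longrightarrow> limit_in m \<gamma> \<longrightarrow> A \<subseteq> underS m \<gamma> \<longrightarrow> cardSuc k \<le>o |A| \<longrightarrow>
      (\<forall>\<beta>\<in>underS m \<gamma>. |A \<inter> underS m \<beta>| \<le>o k) \<longrightarrow>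
      (\<exists>A'\<subseteq>A. cardSuc k \<le>o |A'| \<and> (\<forall>\<beta>\<in>underS m \<gamma>. \<exists>\<eta>\<in>underS m \<gamma>. A' \<inter> underS m \<beta> \<in> G \<eta>))"
    using approachable_guessing[OF gch Ck m ap] by (elim exE conjE, intro that)
  have G: "|G \<eta>| <o m" if "\<eta> \<in> Field m" for \<eta> using G' that by (rule bspec)
  have G_down: "K' \<in> G \<eta>" if "K \<in> G \<eta>" "K' \<subseteq> K" for \<eta> K K' using G_down' that by blast
  \<comment> \<open>The exceptional vertices arising at \<open>\<eta>\<close>. There are fewer than
    \<open>m\<close> of them, so regularity yields the bound \<open>g \<eta>\<close>.\<close>
  define H where "H \<eta> = {v\<in>Field m. cardSuc k \<le>o |nbrs_in E v (underS m \<eta>)| } \<union>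
    (\<Union>K\<in>{K\<in>G \<eta>. |common_nbrs (Field m) E K| \<le>o cardSuc k}. common_nbrs (Field m) E K)" for \<eta>
  have "\<forall>\<eta>\<in>Field m. \<exists>x. x \<in> Field m \<and> H \<eta> \<subseteq> underS m x"
  proof
    fix \<eta> assume \<eta>: "\<eta> \<in> Field m"
    have "|{v\<in>Field m. cardSuc k \<le>o |nbrs_in E v (underS m \<eta>)| }| <o m"
      using underS_in_Field[of _ m \<eta>] card_of_underS[OF mD(3) \<eta>]
      by (intro few_vertices_with_many_nbrs[OF gch k SL mD(1,2) m(2)]) auto
    moreover have "|\<Union>K\<in>{K\<in>G \<eta>. |common_nbrs (Field m) E K| \<le>o cardSuc k}. common_nbrs (Field m) E K| <o m"
    proof (rule card_of_UNION_ordLess_infinite_Field_regularCard[OF mD(2,1)])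
      show "|{K\<in>G \<eta>. |common_nbrs (Field m) E K| \<le>o cardSuc k}| <o m"
        by (rule card_of_subset_ordLess[OF _ G[OF \<eta>]]) simp
      show "\<forall>K\<in>{K\<in>G \<eta>. |common_nbrs (Field m) E K| \<le>o cardSuc k}. |common_nbrs (Field m) E K| <o m"
        using ordLeq_ordLess_trans[OF _ m(2)] by blast
    qed
    ultimately have "|H \<eta>| <o m"
      using mD(1) unfolding H_def by (intro Un_Cinfinite_bound_strict)
    moreover have "H \<eta> \<subseteq> Field m" unfolding H_def common_nbrs_def by blast
    ultimately show "\<exists>x. x \<in> Field m \<and> H \<eta> \<subseteq> underS m x"
      using regular_bounded[OF mD(1,2)] by metis
  qed
  from bchoice[OF this] obtain g where
    g: "\<And>\<eta>. \<eta> \<in> Field m \<Longrightarrow> g \<eta> \<in> Field m" "\<And>\<eta>. \<eta> \<in> Field m \<Longrightarrow> H \<eta> \<subseteq> underS m (g \<eta>)" by blast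
  define D where "D = C \<inter> {\<gamma>. limit_in m \<gamma> \<and> (\<forall>\<eta>\<in>underS m \<gamma>. g \<eta> \<in> underS m \<gamma>)}"
  have "club m D"
    unfolding D_def by (rule club_Int[OF m(1) m_unc C club_closure_points[OF m(1) m_unc g(1)]])
  show thesis
  proof (rule that[OF \<open>club m D\<close>], rule ccontr)
    fix \<gamma> v assume \<gamma>: "\<gamma> \<in> D" and v: "v \<in> Field m - underS m \<gamma>"
      and large: "\<not> |nbrs_in E v (underS m \<gamma>)| \<le>o k"
    have \<gamma>D: "\<gamma> \<in> C" "limit_in m \<gamma>" "\<And>\<eta>. \<eta> \<in> underS m \<gamma> \<Longrightarrow> g \<eta> \<in> underS m \<gamma>"
      using \<gamma> unfolding D_def by auto
    have vH: "v \<notin> H \<eta>" if "\<eta> \<in> underS m \<gamma>" for \<eta>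
      using g(2)[OF underS_in_Field[OF that]] underS_underS[OF wo _ \<gamma>D(3)[OF that]] v by blast
    have large': "cardSuc k \<le>o |nbrs_in E v (underS m \<gamma>)|"
      using large not_cardSuc_ordLeq_iff[of k] Ck by blast
    \<comment> \<open>Since \<open>v\<close> is not exceptional at any \<open>\<beta>\<close> below
      \<open>\<gamma>\<close>, its neighbourhood has the small initial segments that the guessing
      requires.\<close>
    have initial: "|nbrs_in E v (underS m \<gamma>) \<inter> underS m \<beta>| \<le>o k" if \<beta>: "\<beta> \<in> underS m \<gamma>" for \<beta>
    proof -
      have "\<not> cardSuc k \<le>o |nbrs_in E v (underS m \<beta>)|"
        using vH[OF \<beta>] v unfolding H_def by blast
      then have "|nbrs_in E v (underS m \<beta>)| \<le>o k" using not_cardSuc_ordLeq_iff[of k] Ck by blast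
      then show ?thesis by (rule card_of_subset_ordLeq[rotated]) (auto simp: nbrs_in_def)
    qed
    have "nbrs_in E v (underS m \<gamma>) \<subseteq> underS m \<gamma>" unfolding nbrs_in_def by blast
    then have "\<exists>A'\<subseteq>nbrs_in E v (underS m \<gamma>). cardSuc k \<le>o |A'| \<and>
        (\<forall>\<beta>\<in>underS m \<gamma>. \<exists>\<eta>\<in>underS m \<gamma>. A' \<inter> underS m \<beta> \<in> G \<eta>)"
      using guess \<gamma>D(1,2) large' initial by simp
    then obtain A' where
      A': "A' \<subseteq> nbrs_in E v (underS m \<gamma>)" "cardSuc k \<le>o |A'|"
      "\<And>\<beta>. \<beta> \<in> underS m \<gamma> \<Longrightarrow> \<exists>\<eta>\<in>underS m \<gamma>. A' \<inter> underS m \<beta> \<in> G \<eta>" by blast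
    obtain A where A: "A \<subseteq> A'" "|A| =o cardSuc k" using subset_of_card[OF _ A'(2)] Cs by blast
    have A\<gamma>: "A \<subseteq> underS m \<gamma>" using A(1) A'(1) unfolding nbrs_in_def by blast
    have AF: "A \<subseteq> Field m" using A\<gamma> underS_in_Field[of _ m \<gamma>] by blast
    show False
    proof (rule SList_no_rich_chain[OF gch k SL wo AF AF A(2)])
      fix a assume a: "a \<in> A"
      then have a\<gamma>: "a \<in> underS m \<gamma>" using A\<gamma> by blast
      show "|A \<inter> underS m a| \<le>o k"
        by (rule card_of_subset_ordLeq[OF _ initial[OF a\<gamma>]]) (use A(1) A'(1) in blast)
      obtain \<eta> where \<eta>: "\<eta> \<in> underS m \<gamma>" "A' \<inter> underS m a \<in> G \<eta>" using A'(3)[OF a\<gamma>] by blast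
      have "A \<inter> underS m a \<in> G \<eta>" using \<eta>(2) by (rule G_down) (use A(1) in blast)
      moreover have "v \<in> common_nbrs (Field m) E (A \<inter> underS m a)"
        using v A(1) A'(1) unfolding common_nbrs_def nbrs_in_def by blast
      \<comment> \<open>The vertex \<open>v\<close> is itself a common neighbour of this segment, so
        few common neighbours would have put \<open>v\<close> into \<open>H \<eta>\<close>.\<close>
      ultimately have "\<not> |common_nbrs (Field m) E (A \<inter> underS m a)| \<le>o cardSuc k"
        using vH[OF \<eta>(1)] unfolding H_def by blast
      then show "cardSuc k <o |common_nbrs (Field m) E (A \<inter> underS m a)|"
        using not_ordLeq_card_iff(1)[of "cardSuc k"] Cs by blast
    qed
  qed
qed

section \<open>The bound without approachability\<close>

lemma card_of_induct [case_names less]: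
  assumes "\<And>V. (\<And>U. |U| <o |V| \<Longrightarrow> P U) \<Longrightarrow> P V"
  shows "P (V :: 'u set)"
  using wf_inv_image[OF wf_ordLess, of card_of]
proof (induction V rule: wf_induct_rule)
  case (less V)
  show ?case by (rule assms, rule less) (simp add: in_inv_image)
qed

text \<open>Taking the intersection of all closed supersets makes monotonicity in \<open>B\<close>
  immediate; the size is estimated separately by building a closed superset in stages.\<close>

definition nbr_closure :: "'u set \<Rightarrow> 'u set set \<Rightarrow> 'u rel \<Rightarrow> 'u set \<Rightarrow> 'u set" where
  "nbr_closure V E k B =
    \<Inter>{X. X \<subseteq> V \<and> B \<subseteq> X \<and> (\<forall>v\<in>V. cardSuc k \<le>o |nbrs_in E v X| \<longrightarrow> v \<in> X)}"

lemma nbr_closure_mono: "A \<subseteq> B \<Longrightarrow> nbr_closure V E k A \<subseteq> nbr_closure V E k B"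
  unfolding nbr_closure_def by (rule Inter_anti_mono) auto

lemma subset_nbr_closure: "B \<subseteq> nbr_closure V E k B"
  unfolding nbr_closure_def by auto

lemma nbrs_in_mono: "A \<subseteq> B \<Longrightarrow> nbrs_in E v A \<subseteq> nbrs_in E v B"
  unfolding nbrs_in_def by auto

text \<open>Some closed \<open>X\<close> avoids \<open>v\<close> and so contains few of its
  neighbours, and the closure lies inside \<open>X\<close>.\<close>

lemma nbrs_in_nbr_closure:
  assumes "Card_order k" "v \<in> V" "v \<notin> nbr_closure V E k B"
  shows "|nbrs_in E v (nbr_closure V E k B)| \<le>o k"
proof -
  obtain X where X: "X \<subseteq> V" "B \<subseteq> X" "\<forall>v\<in>V. cardSuc k \<le>o |nbrs_in E v X| \<longrightarrow> v \<in> X" "v \<notin> X"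
    using assms(3) unfolding nbr_closure_def by blast
  then have "|nbrs_in E v X| \<le>o k"
    using assms(2) not_cardSuc_ordLeq_iff[OF assms(1)] by blast
  moreover have "nbr_closure V E k B \<subseteq> X" unfolding nbr_closure_def using X by blast
  ultimately show ?thesis using card_of_subset_ordLeq nbrs_in_mono by metis
qed

text \<open>Adding the vertices with many neighbours \<omega> times suffices: if a vertex has
  \<open>cardSuc k\<close> neighbours in the union, the pigeonhole principle gives that many in a
  single stage.\<close>

lemma card_of_nbr_closure:
  fixes k :: "'u rel" and l :: "'c rel"
  assumes gch: "GCH TYPE('u)" and k: "regular_cardinal k" and SL: "SList V E k"
    and l: "Cinfinite l" "cardSuc k \<le>o l" and B: "B \<subseteq> V" "|B| \<le>o l"
  shows "|nbr_closure V E k B| \<le>o l"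
proof -
  have Ck: "Cinfinite k" using regular_cardinalD(1)[OF k] .
  \<comment> \<open>Vertices are counted at the successor of \<open>l\<close>, which is regular even
    when \<open>l\<close> is singular.\<close>
  have sl: "Cinfinite (cardSuc l)" "regularCard (cardSuc l)" "cardSuc k <o cardSuc l"
    using l(1) Cinfinite_cardSuc infinite_cardSuc_regularCard[of l]
      ordLeq_ordLess_trans[OF l(2) cardSuc_greater] by (auto simp: cinfinite_def)
  have less_iff: "|X| <o cardSuc l \<longleftrightarrow> |X| \<le>o l" for X :: "'u set"
    using cardSuc_ordLeq_ordLess[of l "|X|"] l(1) by simp
  define F where "F X = X \<union> {v\<in>V. cardSuc k \<le>o |nbrs_in E v X| }" for X
  define Bs where "Bs n = (F ^^ n) B" for n
  have Bs: "Bs 0 = B" "Bs (Suc n) = F (Bs n)" for n unfolding Bs_def by simp_all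
  have size: "Bs n \<subseteq> V \<and> |Bs n| \<le>o l" for n
  proof (induction n)
    case 0
    then show ?case using B by (simp add: Bs)
  next
    case (Suc n)
    then have "|{v\<in>V. cardSuc k \<le>o |nbrs_in E v (Bs n)| }| \<le>o l"
      using few_vertices_with_many_nbrs[OF gch k SL sl, of "Bs n"] less_iff by simp
    then have "|Bs (Suc n)| \<le>o l"
      using Suc l(1) unfolding Bs F_def by (intro Un_Cinfinite_bound) auto
    then show ?case using Suc unfolding Bs F_def by blast
  qed
  have nat_k: "|UNIV :: nat set| \<le>o k"
    by (rule ordIso_ordLeq_trans[OF card_of_nat natLeq_ordLeq_cinfinite[OF Ck]])
  have nat_l: "|UNIV :: nat set| \<le>o l"
    by (rule ordIso_ordLeq_trans[OF card_of_nat natLeq_ordLeq_cinfinite[OF l(1)]])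
  have "v \<in> (\<Union>n. Bs n)" if v: "v \<in> V" "cardSuc k \<le>o |nbrs_in E v (\<Union>n. Bs n)|" for v
  proof -
    have "nbrs_in E v (\<Union>n. Bs n) \<subseteq> (\<Union>n\<in>UNIV. Bs n)" unfolding nbrs_in_def by blast
    from pigeonhole_cardSuc[OF Ck nat_k this v(2)] obtain n where
      n: "cardSuc k \<le>o |nbrs_in E v (\<Union>n. Bs n) \<inter> Bs n|" by blast
    have "nbrs_in E v (\<Union>n. Bs n) \<inter> Bs n \<subseteq> nbrs_in E v (Bs n)" unfolding nbrs_in_def by blast
    then have "cardSuc k \<le>o |nbrs_in E v (Bs n)|"
      by (rule ordLeq_transitive[OF n card_of_mono1])
    then have "v \<in> Bs (Suc n)" using v(1) unfolding Bs F_def by blast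
    then show ?thesis by blast
  qed
  moreover have "(\<Union>n. Bs n) \<subseteq> V" "B \<subseteq> (\<Union>n. Bs n)" using size Bs(1) by blast+
  ultimately have "nbr_closure V E k B \<subseteq> (\<Union>n. Bs n)"
    unfolding nbr_closure_def by (intro Inter_lower) simp
  moreover have "|\<Union>n. Bs n| \<le>o l"
    using nat_l size l(1) by (intro UNION_Cinfinite_bound) simp_all
  ultimately show ?thesis by (rule card_of_subset_ordLeq)
qed

lemma wo_minim:
  assumes "Well_order r" "B \<subseteq> Field r" "B \<noteq> {}"
  shows "wo_rel.minim r B \<in> B" "x \<in> underS r (wo_rel.minim r B) \<Longrightarrow> x \<notin> B"
proof -
  have wr: "wo_rel r" using assms(1) by (simp add: wo_rel_def)
  show *: "wo_rel.minim r B \<in> B" by (rule wo_rel.minim_in[OF wr assms(2,3)])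
  assume x: "x \<in> underS r (wo_rel.minim r B)"
  show "x \<notin> B"
  proof
    assume "x \<in> B"
    then have "(wo_rel.minim r B, x) \<in> r" by (rule wo_rel.minim_least[OF wr assms(2)])
    then show False
      using x notin_underS_iff[OF assms(1), of x "wo_rel.minim r B"] \<open>x \<in> B\<close> * assms(2) by blast
  qed
qed

text \<open>Closures of initial segments form an increasing chain exhausting \<open>V\<close>, and
  \<open>\<rho> v\<close> is the first index whose closure contains \<open>v\<close>. Each earlier
  closure omits \<open>v\<close>, hence holds at most \<open>k\<close> of its neighbours, so their
  union holds at most \<open>cardSuc k\<close>.\<close>

lemma Col_cardSuc_cardSuc:
  fixes k :: "'u rel"
  assumes gch: "GCH TYPE('u)" and k: "regular_cardinal k"
  shows "SList V E k \<Longrightarrow> Col V E (cardSuc (cardSuc k))"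
proof (induction V rule: card_of_induct)
  case (less V)
  have Ck: "Cinfinite k" using regular_cardinalD(1)[OF k] .
  have Cs: "Cinfinite (cardSuc k)" using Cinfinite_cardSuc[OF Ck] .
  have Css: "Cinfinite (cardSuc (cardSuc k))" using Cinfinite_cardSuc[OF Cs] .
  show ?case
  proof (cases "|V| \<le>o cardSuc k")
    case True
    have "|V| \<le>o cardSuc (cardSuc k)"
      using Cs by (intro ordLeq_transitive[OF True cardSuc_ordLeq]) simp
    then show ?thesis using Css by (intro Col_small) simp_all
  next
    case False
    then have big: "cardSuc k <o |V|" using not_ordLeq_card_iff(1)[of "cardSuc k" V] Cs by blast
    have CV: "Cinfinite |V|"
      using cinfinite_mono[OF ordLess_imp_ordLeq[OF big]] Cs by simp
    have wo: "Well_order |V|" by (rule card_of_Well_order)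
    \<comment> \<open>\<open>Z\<close> pads short initial segments in the size estimate, as closures
      are controlled only from size \<open>cardSuc k\<close> upwards.\<close>
    obtain Z where Z: "Z \<subseteq> V" "|Z| =o cardSuc k"
      using subset_of_card[OF _ ordLess_imp_ordLeq[OF big]] Cs by blast
    define B where "B x = nbr_closure V E k (under |V| x)" for x
    have B_less: "|B x| <o |V|" if x: "x \<in> V" for x
    proof -
      have u: "|under |V| x| <o |V|" using x by (intro card_of_under[OF CV]) simp
      have "|Z| <o |V|" by (rule ordIso_ordLess_trans[OF Z(2) big])
      then have zu: "|Z \<union> under |V| x| <o |V|" using u CV by (intro Un_Cinfinite_bound_strict)
      have kz: "cardSuc k \<le>o |Z \<union> under |V| x|"
        by (rule ordIso_ordLeq_trans[OF ordIso_symmetric[OF Z(2)] card_of_mono1]) simp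
      have "Cinfinite |Z \<union> under |V| x|"
        using cinfinite_mono[OF kz] Cs by simp
      then have "|B x| \<le>o |Z \<union> under |V| x|"
        unfolding B_def using under_Field[of "|V|" x]
        by (intro card_of_nbr_closure[OF gch k less.prems _ kz]) (simp_all add: card_of_mono1)
      then show ?thesis by (rule ordLeq_ordLess_trans[OF _ zu])
    qed
    have B_self: "v \<in> B v" if "v \<in> V" for v
      using subset_nbr_closure[of "under |V| v" V E k] that Refl_under_in[of "|V|" v]
        wo_rel.REFL[of "|V|"] wo unfolding B_def wo_rel_def by auto
    have B_mono: "B x \<subseteq> B y" if "(x, y) \<in> |V|" for x y
      unfolding B_def using that wo_rel.TRANS[of "|V|"] wo
      by (intro nbr_closure_mono under_incr) (simp_all add: wo_rel_def)
    define \<rho> where "\<rho> v = wo_rel.minim |V| {x\<in>V. v \<in> B x}" for v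
    have \<rho>: "\<rho> v \<in> V" "v \<in> B (\<rho> v)" "\<And>x. x \<in> underS |V| (\<rho> v) \<Longrightarrow> v \<notin> B x" if v: "v \<in> V" for v
    proof -
      have ne: "{x\<in>V. v \<in> B x} \<subseteq> Field |V|" "{x\<in>V. v \<in> B x} \<noteq> {}" using B_self[OF v] v by auto
      show "\<rho> v \<in> V" "v \<in> B (\<rho> v)" using wo_minim(1)[OF wo ne] unfolding \<rho>_def by auto
      show "v \<notin> B x" if x: "x \<in> underS |V| (\<rho> v)" for x
        using wo_minim(2)[OF wo ne] x underS_in_Field[OF x] unfolding \<rho>_def by auto
    qed
    show ?thesis
    proof (rule Col_assemble[OF wo _ Css, of V \<rho>])
      show "\<rho> v \<in> Field |V|" if "v \<in> V" for v using \<rho>(1)[OF that] by simp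
    next
      fix i assume i: "i \<in> Field |V|"
      have "{v\<in>V. \<rho> v = i} \<subseteq> B i" using \<rho>(2) by blast
      then have "|{v\<in>V. \<rho> v = i}| <o |V|" by (rule card_of_subset_ordLess) (use B_less i in simp)
      moreover have "SList {v\<in>V. \<rho> v = i} E k" by (rule SList_subset[OF k less.prems]) blast
      ultimately show "Col {v\<in>V. \<rho> v = i} E (cardSuc (cardSuc k))" by (rule less.IH)
    next
      fix v assume v: "v \<in> V"
      define \<F> where "\<F> = (\<lambda>y. nbrs_in E v (B y)) ` underS |V| (\<rho> v)"
      have "|\<Union>\<F>| \<le>o cardSuc k"
      proof (rule card_of_Union_chain[OF Ck])
        fix X Y assume "X \<in> \<F>" "Y \<in> \<F>"
        then obtain x y where xy: "x \<in> underS |V| (\<rho> v)" "y \<in> underS |V| (\<rho> v)"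
          "X = nbrs_in E v (B x)" "Y = nbrs_in E v (B y)" unfolding \<F>_def by blast
        have "(x, y) \<in> |V| \<or> (y, x) \<in> |V|"
          using wo_rel.TOTALS[of "|V|"] wo underS_in_Field[OF xy(1)] underS_in_Field[OF xy(2)]
          unfolding wo_rel_def by blast
        then show "X \<subseteq> Y \<or> Y \<subseteq> X" using B_mono nbrs_in_mono unfolding xy(3,4) by metis
      next
        fix X assume "X \<in> \<F>"
        then obtain x where x: "x \<in> underS |V| (\<rho> v)" "X = nbrs_in E v (B x)" unfolding \<F>_def by blast
        show "|X| \<le>o k"
          using \<rho>(3)[OF v x(1)] Ck v unfolding x(2) B_def by (intro nbrs_in_nbr_closure) simp_all
      qed
      moreover have "{w\<in>V. \<rho> w \<in> underS |V| (\<rho> v) \<and> {v, w} \<in> E} \<subseteq> \<Union>\<F>"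
        using \<rho>(2) unfolding \<F>_def nbrs_in_def by blast
      ultimately have "|{w\<in>V. \<rho> w \<in> underS |V| (\<rho> v) \<and> {v, w} \<in> E}| \<le>o cardSuc k"
        by (rule card_of_subset_ordLeq[rotated])
      then show "|{w\<in>V. \<rho> w \<in> underS |V| (\<rho> v) \<and> {v, w} \<in> E}| <o cardSuc (cardSuc k)"
        using Cs by (intro ordLeq_ordLess_trans[OF _ cardSuc_greater]) simp_all
    qed
  qed
qed

section \<open>The bound with approachability\<close>

text \<open>Recasts the well-order as an orientation of the edges with at most \<open>k\<close>
  edges leaving each vertex, the form in which sets are closed off below.\<close>

lemma Col_smaller_nbrs:
  assumes k: "Card_order k" and "Col U E (cardSuc k)"
  shows "\<exists>s. (\<forall>x\<in>U. s x \<subseteq> U \<and> |s x| \<le>o k) \<and>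
    (\<forall>x\<in>U. \<forall>y\<in>U. x \<noteq> y \<and> {x, y} \<in> E \<longrightarrow> y \<in> s x \<or> x \<in> s y)"
proof -
  obtain q where q: "well_order_on U q"
    "\<And>v. v \<in> U \<Longrightarrow> |{w\<in>U. w \<in> underS q v \<and> {v, w} \<in> E}| <o cardSuc k"
    using assms(2) unfolding Col_def by blast
  define s where "s x = {w\<in>U. w \<in> underS q x \<and> {x, w} \<in> E}" for x
  have "|s x| \<le>o k" if "x \<in> U" for x
    using q(2)[OF that] cardSuc_ordLeq_ordLess[of k "|s x|"] k unfolding s_def by simp
  moreover have "y \<in> s x \<or> x \<in> s y" if "x \<in> U" "y \<in> U" "x \<noteq> y" "{x, y} \<in> E" for x y
  proof -
    have "x \<in> underS q y \<or> y \<in> underS q x"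
      using q(1) that unfolding well_order_on_def linear_order_on_def total_on_def underS_def by blast
    then show ?thesis using that unfolding s_def by (auto simp: insert_commute)
  qed
  ultimately show ?thesis by (intro exI[of _ s]) (auto simp: s_def)
qed

text \<open>
  Each piece is closed under the smaller neighbours of all the other pieces at once, so no
  continuity of the chain of pieces is needed.
\<close>

lemma Col_singular:
  fixes k :: "'u rel" and V :: "'u set"
  assumes k: "Cinfinite k" and V: "k <o |V|" "\<not> regularCard |V|"
    and smaller: "\<And>U. U \<subseteq> V \<Longrightarrow> |U| <o |V| \<Longrightarrow> Col U E (cardSuc k)"
  shows "Col V E (cardSuc k)"
proof -
  have CV: "Cinfinite |V|"
    using cinfinite_mono[OF ordLess_imp_ordLeq[OF V(1)]] k by simp
  have wo: "Well_order |V|" by (rule card_of_Well_order)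
  have TR: "trans |V|" using wo_rel.TRANS[of "|V|"] wo by (simp add: wo_rel_def)
  \<comment> \<open>Singularity provides a cofinal index set smaller than
    \<open>|V|\<close>.\<close>
  obtain I where I: "I \<subseteq> V" "cofinal I |V|" "\<not> |I| =o |V|"
    using V(2) unfolding regularCard_def by auto
  have I_less: "|I| <o |V|"
    using card_of_mono1[OF I(1)] I(3) ordLeq_iff_ordLess_or_ordIso by blast
  obtain Z where Z: "Z \<subseteq> V" "|Z| =o k"
    using subset_of_card[OF _ ordLess_imp_ordLeq[OF V(1)]] k by blast
  have "\<forall>U\<in>{U. U \<subseteq> V \<and> |U| <o |V| }. \<exists>s. (\<forall>x\<in>U. s x \<subseteq> U \<and> |s x| \<le>o k) \<and>
      (\<forall>x\<in>U. \<forall>y\<in>U. x \<noteq> y \<and> {x, y} \<in> E \<longrightarrow> y \<in> s x \<or> x \<in> s y)"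
    using Col_smaller_nbrs[OF _ smaller] k by simp
  from bchoice[OF this] obtain s where
    s': "\<forall>U\<in>{U. U \<subseteq> V \<and> |U| <o |V| }. (\<forall>x\<in>U. s U x \<subseteq> U \<and> |s U x| \<le>o k) \<and>
      (\<forall>x\<in>U. \<forall>y\<in>U. x \<noteq> y \<and> {x, y} \<in> E \<longrightarrow> y \<in> s U x \<or> x \<in> s U y)"
    by (rule exE)
  have s: "x \<in> U \<Longrightarrow> s U x \<subseteq> U" "x \<in> U \<Longrightarrow> |s U x| \<le>o k"
    "x \<in> U \<Longrightarrow> y \<in> U \<Longrightarrow> x \<noteq> y \<Longrightarrow> {x, y} \<in> E \<Longrightarrow> y \<in> s U x \<or> x \<in> s U y"
    if "U \<subseteq> V" "|U| <o |V|" for U x y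
    using bspec[OF s', of U] that by simp_all
  \<comment> \<open>The \<open>i\<close>-th piece absorbs the smaller neighbours of its elements
    with respect to every piece \<open>f l\<close> containing them. The orientation
    \<open>s (f l)\<close> belongs to the current stage of that piece and may change at the next
    one.\<close>
  define F where "F f i = f i \<union> (\<Union>l\<in>I. \<Union>x\<in>f i \<inter> f l. s (f l) x)" for f :: "'u \<Rightarrow> 'u set" and i
  define B where "B n = (F ^^ n) (underS |V| )" for n
  have B0: "B 0 i = underS |V| i" and BS: "B (Suc n) i = F (B n) i" for n i
    unfolding B_def by simp_all
  \<comment> \<open>A size bound valid at all stages: it absorbs unions over \<open>I\<close> and
    sets of size \<open>k\<close>, yet stays below \<open>|V|\<close>.\<close>
  define T where "T i = I \<union> Z \<union> underS |V| i" for i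
  have T: "Cinfinite |T i|" "|T i| <o |V|" "|I| \<le>o |T i|" "k \<le>o |T i|" if i: "i \<in> I" for i
  proof -
    have "|Z| <o |V|" by (rule ordIso_ordLess_trans[OF Z(2) V(1)])
    moreover have "|underS |V| i| <o |V|"
      using i I(1) by (intro card_of_underS) auto
    ultimately show "|T i| <o |V|"
      unfolding T_def using I_less CV by (intro Un_Cinfinite_bound_strict)
    show "|I| \<le>o |T i|" unfolding T_def by (intro card_of_mono1) blast
    show kT: "k \<le>o |T i|"
      unfolding T_def by (rule ordIso_ordLeq_trans[OF ordIso_symmetric[OF Z(2)] card_of_mono1]) blast
    show "Cinfinite |T i|" using cinfinite_mono[OF kT] k by simp
  qed
  have size: "\<forall>i\<in>I. B n i \<subseteq> V \<and> |B n i| \<le>o |T i|" for n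
  proof (induction n)
    case 0
    have "B 0 i \<subseteq> V" for i unfolding B0 using underS_in_Field[of _ "|V|" i] by auto
    moreover have "|B 0 i| \<le>o |T i|" for i unfolding B0 T_def by (intro card_of_mono1) blast
    ultimately show ?case by blast
  next
    case (Suc n)
    show ?case
    proof
      fix i assume i: "i \<in> I"
      have l_less: "B n l \<subseteq> V" "|B n l| <o |V|" if "l \<in> I" for l
        using Suc that ordLeq_ordLess_trans[OF _ T(2)[OF that]] by blast+
      have "|\<Union>l\<in>I. \<Union>x\<in>B n i \<inter> B n l. s (B n l) x| \<le>o |T i|"
      proof (rule UNION_Cinfinite_bound[OF T(3)[OF i] _ T(1)[OF i]], rule ballI)
        fix l assume l: "l \<in> I"
        have "|B n i \<inter> B n l| \<le>o |T i|"
          by (rule card_of_subset_ordLeq[of _ "B n i"]) (use Suc i in auto)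
        then show "|\<Union>x\<in>B n i \<inter> B n l. s (B n l) x| \<le>o |T i|"
        proof (rule UNION_Cinfinite_bound[OF _ _ T(1)[OF i]], intro ballI)
          fix x assume "x \<in> B n i \<inter> B n l"
          then have "|s (B n l) x| \<le>o k" by (intro s(2)[OF l_less[OF l]]) blast
          then show "|s (B n l) x| \<le>o |T i|" by (rule ordLeq_transitive[OF _ T(4)[OF i]])
        qed
      qed
      then have "|B (Suc n) i| \<le>o |T i|"
        unfolding BS F_def using Suc i T(1)[OF i] by (intro Un_Cinfinite_bound) simp_all
      moreover have "B (Suc n) i \<subseteq> V"
      proof -
        have "s (B n l) x \<subseteq> V" if "l \<in> I" "x \<in> B n i \<inter> B n l" for l x
          using s(1)[OF l_less[OF that(1)], of x] l_less(1)[OF that(1)] that(2) by blast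
        then show ?thesis unfolding BS F_def using l_less(1)[OF i] by blast
      qed
      ultimately show "B (Suc n) i \<subseteq> V \<and> |B (Suc n) i| \<le>o |T i|" by blast
    qed
  qed
  have B_less: "B n i \<subseteq> V" "|B n i| <o |V|" if "i \<in> I" for n i
    using size[of n] that ordLeq_ordLess_trans[OF _ T(2)[OF that]] by blast+
  have B_n: "B n i \<subseteq> B n' i" if "n \<le> n'" for n n' i
    using that
  proof (induction n' rule: dec_induct)
    case (step n')
    then show ?case unfolding BS F_def by blast
  qed simp
  have B_i: "B n i \<subseteq> B n j" if "(i, j) \<in> |V|" for n i j
  proof (induction n)
    case 0
    show ?case unfolding B0 using underS_trans[OF wo _ that] by blast
  next
    case (Suc n)
    then show ?case unfolding BS F_def by blast
  qed
  have B_closed: "s (B n l) x \<subseteq> B (Suc n) i" if "l \<in> I" "x \<in> B n i" "x \<in> B n l" for n l x i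
    unfolding BS F_def using that by blast
  have nat_k: "|UNIV :: nat set| \<le>o q" if "Cinfinite q" for q :: "'q rel"
    by (rule ordIso_ordLeq_trans[OF card_of_nat natLeq_ordLeq_cinfinite[OF that]])
  define \<rho> where "\<rho> v = wo_rel.minim |V| {i\<in>I. v \<in> (\<Union>n. B n i)}" for v
  have \<rho>: "\<rho> v \<in> I" "v \<in> (\<Union>n. B n (\<rho> v))"
      "\<And>i n. i \<in> underS |V| (\<rho> v) \<Longrightarrow> i \<in> I \<Longrightarrow> v \<notin> B n i" if v: "v \<in> V" for v
  proof -
    obtain i where "i \<in> I" "v \<in> underS |V| i"
      using I(2) v unfolding cofinal_def underS_def by auto
    then have "i \<in> {i\<in>I. v \<in> (\<Union>n. B n i)}" using B0 by blast
    then have ne: "{i\<in>I. v \<in> (\<Union>n. B n i)} \<subseteq> Field |V|" "{i\<in>I. v \<in> (\<Union>n. B n i)} \<noteq> {}"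
      using I(1) by auto
    show "\<rho> v \<in> I" "v \<in> (\<Union>n. B n (\<rho> v))" using wo_minim(1)[OF wo ne] unfolding \<rho>_def by auto
    show "v \<notin> B n i" if "i \<in> underS |V| (\<rho> v)" "i \<in> I" for i n
      using wo_minim(2)[OF wo ne] that unfolding \<rho>_def by blast
  qed
  show ?thesis
  proof (rule Col_assemble[OF wo _ Cinfinite_cardSuc[OF k], of V \<rho>])
    show "\<rho> v \<in> Field |V|" if "v \<in> V" for v using \<rho>(1)[OF that] I(1) by auto
  next
    fix i assume "i \<in> Field |V|"
    have "|{v\<in>V. \<rho> v = i}| <o |V|"
    proof (cases "i \<in> I")
      case True
      have "|\<Union>n. B n i| \<le>o |T i|"
        by (rule UNION_Cinfinite_bound[OF nat_k[OF T(1)[OF True]] _ T(1)[OF True]])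
          (use size True in blast)
      then have "|\<Union>n. B n i| <o |V|" by (rule ordLeq_ordLess_trans[OF _ T(2)[OF True]])
      moreover have "{v\<in>V. \<rho> v = i} \<subseteq> (\<Union>n. B n i)" using \<rho>(2) by blast
      ultimately show ?thesis by (rule card_of_subset_ordLess[rotated])
    next
      case False
      then have empty: "{v\<in>V. \<rho> v = i} = {}" using \<rho>(1) by blast
      have "|{} :: 'u set| <o |V|"
        by (rule Cfinite_ordLess_Cinfinite[OF _ CV]) (simp add: cfinite_def)
      then show ?thesis unfolding empty .
    qed
    then show "Col {v\<in>V. \<rho> v = i} E (cardSuc k)" by (intro smaller) blast
  next
    fix v assume v: "v \<in> V"
    \<comment> \<open>The smaller neighbours of \<open>v\<close> at each stage of its own piece; the
      empty default covers stages that \<open>v\<close> has not yet entered.\<close>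
    define N where "N n = (if v \<in> B n (\<rho> v) then s (B n (\<rho> v)) v else {})" for n
    have "{w\<in>V. \<rho> w \<in> underS |V| (\<rho> v) \<and> {v, w} \<in> E} \<subseteq> (\<Union>n. N n)"
    proof
      fix w assume "w \<in> {w\<in>V. \<rho> w \<in> underS |V| (\<rho> v) \<and> {v, w} \<in> E}"
      then have w: "w \<in> V" "\<rho> w \<in> underS |V| (\<rho> v)" "{v, w} \<in> E" by auto
      obtain a b where ab: "v \<in> B a (\<rho> v)" "w \<in> B b (\<rho> w)" using \<rho>(2)[OF v] \<rho>(2)[OF w(1)] by blast
      define n where "n = max a b"
      have vn: "v \<in> B n (\<rho> v)" using ab(1) B_n[of a n] unfolding n_def by auto
      have wn: "w \<in> B n (\<rho> w)" using ab(2) B_n[of b n] unfolding n_def by auto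
      have wn': "w \<in> B n (\<rho> v)" using wn B_i[OF underS_imp_le[OF w(2)]] by blast
      have "v \<noteq> w" using w(2) underS_notIn[of "\<rho> v" "|V|"] by auto
      then have "w \<in> s (B n (\<rho> v)) v \<or> v \<in> s (B n (\<rho> v)) w"
        using s(3)[OF B_less[OF \<rho>(1)[OF v]] vn wn'] w(3) by simp
      \<comment> \<open>Otherwise the next stage of the piece at \<open>\<rho> w\<close>, which
        contains \<open>w\<close>, would have absorbed \<open>v\<close>, against the minimality of
        \<open>\<rho> v\<close>.\<close>
      moreover have "v \<notin> s (B n (\<rho> v)) w"
        using B_closed[OF \<rho>(1)[OF v] wn wn'] \<rho>(3)[OF v w(2) \<rho>(1)[OF w(1)]] by blast
      ultimately have "w \<in> N n" unfolding N_def using vn by simp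
      then show "w \<in> (\<Union>n. N n)" by blast
    qed
    moreover have "|\<Union>n. N n| \<le>o k"
    proof (rule UNION_Cinfinite_bound[OF nat_k[OF k] _ k], rule ballI)
      fix n
      show "|N n| \<le>o k"
      proof (cases "v \<in> B n (\<rho> v)")
        case True
        then show ?thesis using s(2)[OF B_less[OF \<rho>(1)[OF v]], of v n] unfolding N_def by simp
      next
        case False
        then have empty: "N n = {}" unfolding N_def by simp
        show ?thesis unfolding empty using k by (intro Card_order_empty) simp
      qed
    qed
    ultimately have "|{w\<in>V. \<rho> w \<in> underS |V| (\<rho> v) \<and> {v, w} \<in> E}| \<le>o k"
      by (rule card_of_subset_ordLeq)
    then show "|{w\<in>V. \<rho> w \<in> underS |V| (\<rho> v) \<and> {v, w} \<in> E}| <o cardSuc k"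
      using k by (intro ordLeq_ordLess_trans[OF _ cardSuc_greater]) simp_all
  qed
qed

text \<open>The points of the club \<open>D\<close> cut \<open>Field m\<close> into bounded pieces,
  to which \<open>smaller\<close> applies. The neighbours of \<open>v\<close> in earlier pieces lie
  in the closed initial segment cut off at \<open>\<rho> v\<close>, so there are at most
  \<open>k\<close> of them.\<close>

lemma Col_regular:
  fixes k m :: "'u rel"
  assumes gch: "GCH TYPE('u)" and k: "regular_cardinal k" and SL: "SList (Field m) E k"
    and m: "regular_cardinal m" "cardSuc k <o m" and ap: "Field m \<in> I[m]"
    and smaller: "\<And>U. U \<subseteq> Field m \<Longrightarrow> |U| <o m \<Longrightarrow> Col U E (cardSuc k)"
  shows "Col (Field m) E (cardSuc k)"
proof -
  have Ck: "Cinfinite k" using regular_cardinalD(1)[OF k] .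
  note mD = regular_cardinalD[OF m(1)]
  have wo: "Well_order m" using m(1) by (rule regular_cardinal_wo)
  obtain D where D: "club m D" and closed: "\<And>\<gamma> v. \<gamma> \<in> D \<Longrightarrow> v \<in> Field m - underS m \<gamma> \<Longrightarrow>
      |nbrs_in E v (underS m \<gamma>)| \<le>o k"
    using club_of_closed_segments[OF gch k SL m ap] by blast
  have DF: "D \<subseteq> Field m" using D unfolding club_def unbounded_in_def by blast
  define S where "S v = {x\<in>Field m. \<forall>\<gamma>\<in>D. (\<gamma>, v) \<in> m \<longrightarrow> (\<gamma>, x) \<in> m}" for v
  \<comment> \<open>\<open>\<rho> v\<close> is the least upper bound of the elements of \<open>D\<close> below or equal to \<open>v\<close>\<close>
  define \<rho> where "\<rho> v = wo_rel.minim m (S v)" for v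
  have ne: "S v \<subseteq> Field m" "S v \<noteq> {}" if "v \<in> Field m" for v using that unfolding S_def by auto
  have \<rho>: "\<rho> v \<in> Field m" "\<And>\<gamma>. \<gamma> \<in> D \<Longrightarrow> (\<gamma>, v) \<in> m \<Longrightarrow> (\<gamma>, \<rho> v) \<in> m"
      "\<And>x. x \<in> underS m (\<rho> v) \<Longrightarrow> x \<notin> S v" "v \<notin> underS m (\<rho> v)" if v: "v \<in> Field m" for v
  proof -
    have "\<rho> v \<in> S v" unfolding \<rho>_def by (rule wo_minim(1)[OF wo ne[OF v]])
    then show "\<rho> v \<in> Field m" "\<And>\<gamma>. \<gamma> \<in> D \<Longrightarrow> (\<gamma>, v) \<in> m \<Longrightarrow> (\<gamma>, \<rho> v) \<in> m"
      unfolding S_def by auto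
    show *: "x \<notin> S v" if "x \<in> underS m (\<rho> v)" for x
      using wo_minim(2)[OF wo ne[OF v]] that unfolding \<rho>_def by blast
    have "v \<in> S v" using v unfolding S_def by blast
    then show "v \<notin> underS m (\<rho> v)" using * by blast
  qed
  have between: "\<exists>\<gamma>\<in>D. (\<gamma>, v) \<in> m \<and> x \<in> underS m \<gamma> \<and> (\<gamma>, \<rho> v) \<in> m"
    if v: "v \<in> Field m" and x: "x \<in> underS m (\<rho> v)" for v x
  proof -
    have xF: "x \<in> Field m" using x by (rule underS_in_Field)
    then obtain \<gamma> where \<gamma>: "\<gamma> \<in> D" "(\<gamma>, v) \<in> m" "(\<gamma>, x) \<notin> m"
      using \<rho>(3)[OF v x] unfolding S_def by blast
    then have "x \<in> underS m \<gamma>" using notin_underS_iff[OF wo xF, of \<gamma>] DF by blast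
    then show ?thesis using \<gamma> \<rho>(2)[OF v] by blast
  qed
  show ?thesis
  proof (rule Col_assemble[OF wo \<rho>(1) Cinfinite_cardSuc[OF Ck]])
    fix i assume i: "i \<in> Field m"
    obtain j where j: "j \<in> Field m" "i \<in> underS m j" using exists_greater[OF mD(1) i] .
    \<comment> \<open>Any point of \<open>D\<close> beyond \<open>i\<close> bounds the fibre,
      because a vertex at or above \<open>\<delta>\<close> has its \<open>\<rho>\<close> at or above
      \<open>\<delta>\<close>.\<close>
    obtain \<delta> where \<delta>: "\<delta> \<in> D" "(j, \<delta>) \<in> m" using D j(1) unfolding club_def unbounded_in_def by blast
    have i\<delta>: "i \<in> underS m \<delta>" by (rule underS_trans[OF wo j(2) \<delta>(2)])
    have "{v\<in>Field m. \<rho> v = i} \<subseteq> underS m \<delta>"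
    proof (intro subsetI, rule ccontr)
      fix v assume v: "v \<in> {v\<in>Field m. \<rho> v = i}" "v \<notin> underS m \<delta>"
      then have "(\<delta>, v) \<in> m" using notin_underS_iff[OF wo, of v \<delta>] \<delta>(1) DF by blast
      then have "(\<delta>, i) \<in> m" using \<rho>(2)[of v \<delta>] v(1) \<delta>(1) by blast
      then show False using notin_underS_iff[OF wo i, of \<delta>] \<delta>(1) DF i\<delta> by blast
    qed
    then have "|{v\<in>Field m. \<rho> v = i}| <o m"
      by (rule card_of_subset_ordLess) (use card_of_underS[OF mD(3)] \<delta>(1) DF in blast)
    then show "Col {v\<in>Field m. \<rho> v = i} E (cardSuc k)" by (intro smaller) blast
  next
    fix v assume v: "v \<in> Field m"
    have "|{w\<in>Field m. \<rho> w \<in> underS m (\<rho> v) \<and> {v, w} \<in> E}| \<le>o k"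
    proof (cases "\<rho> v \<in> D")
      case True
      have "|nbrs_in E v (underS m (\<rho> v))| \<le>o k" using closed[OF True] v \<rho>(4)[OF v] by blast
      moreover have "{w\<in>Field m. \<rho> w \<in> underS m (\<rho> v) \<and> {v, w} \<in> E} \<subseteq> nbrs_in E v (underS m (\<rho> v))"
      proof
        fix w assume w: "w \<in> {w\<in>Field m. \<rho> w \<in> underS m (\<rho> v) \<and> {v, w} \<in> E}"
        then obtain \<gamma> where \<gamma>: "\<gamma> \<in> D" "\<rho> w \<in> underS m \<gamma>" "(\<gamma>, \<rho> v) \<in> m" using between[OF v] by blast
        have \<gamma>F: "\<gamma> \<in> Field m" using \<gamma>(1) DF by blast
        have "(\<gamma>, \<rho> w) \<notin> m" using \<gamma>(2) notin_underS_iff[OF wo \<rho>(1) \<gamma>F, of w] w by blast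
        then have "(\<gamma>, w) \<notin> m" using \<rho>(2)[of w \<gamma>] \<gamma>(1) w by blast
        then have "w \<in> underS m \<gamma>" using notin_underS_iff[OF wo _ \<gamma>F, of w] w by blast
        then have "w \<in> underS m (\<rho> v)" by (rule underS_trans[OF wo _ \<gamma>(3)])
        then show "w \<in> nbrs_in E v (underS m (\<rho> v))" using w unfolding nbrs_in_def by blast
      qed
      ultimately show ?thesis by (rule card_of_subset_ordLeq[rotated])
    next
      case False
      \<comment> \<open>A supremum of a nonempty part of the club \<open>D\<close> belongs to
        \<open>D\<close>. So here no point of \<open>D\<close> lies at or below \<open>v\<close>,
        and \<open>\<rho> v\<close> is the least ordinal.\<close>
      have no: "underS m (\<rho> v) = {}"
      proof (rule ccontr)
        assume nonempty: "underS m (\<rho> v) \<noteq> {}"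
        have b: "\<exists>\<gamma>\<in>D. x \<in> underS m \<gamma> \<and> \<gamma> \<in> underS m (\<rho> v)" if "x \<in> underS m (\<rho> v)" for x
          using between[OF v that] False unfolding underS_def by blast
        have "limit_in m (\<rho> v)"
          unfolding limit_in_def
        proof (intro conjI ballI)
          fix x assume "x \<in> underS m (\<rho> v)"
          then show "\<exists>\<beta>\<in>underS m (\<rho> v). x \<in> underS m \<beta>" using b by blast
        qed (fact \<rho>(1)[OF v], fact nonempty)
        moreover have "cofinal_below m (\<rho> v) (D \<inter> underS m (\<rho> v))"
          unfolding cofinal_below_def
        proof (intro conjI ballI)
          fix x assume "x \<in> underS m (\<rho> v)"
          then obtain \<gamma> where \<gamma>: "\<gamma> \<in> D" "x \<in> underS m \<gamma>" "\<gamma> \<in> underS m (\<rho> v)" using b by blast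
          then show "\<exists>\<beta>\<in>D \<inter> underS m (\<rho> v). (x, \<beta>) \<in> m"
            by (intro bexI[of _ \<gamma>] underS_imp_le) simp_all
        qed simp
        ultimately show False using D False unfolding club_def by blast
      qed
      have empty: "{w\<in>Field m. \<rho> w \<in> underS m (\<rho> v) \<and> {v, w} \<in> E} = {}" unfolding no by simp
      show ?thesis unfolding empty using Ck by (intro Card_order_empty) simp
    qed
    then show "|{w\<in>Field m. \<rho> w \<in> underS m (\<rho> v) \<and> {v, w} \<in> E}| <o cardSuc k"
      using Ck by (intro ordLeq_ordLess_trans[OF _ cardSuc_greater]) simp_all
  qed
qed

text \<open>Induction on \<open>|V|\<close>, splitting into regular and singular sizes. In the
  regular case approachability is invoked for the cardinal well-order of \<open>V\<close> itself, so
  that vertices double as ordinals.\<close>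

lemma Col_cardSuc:
  fixes k :: "'u rel"
  assumes gch: "GCH TYPE('u)" and k: "regular_cardinal k"
    and ap: "\<And>m :: 'u rel. regular_cardinal m \<Longrightarrow> Field m \<in> I[m]"
  shows "SList V E k \<Longrightarrow> Col V E (cardSuc k)"
proof (induction V rule: card_of_induct)
  case (less V)
  have Ck: "Cinfinite k" using regular_cardinalD(1)[OF k] .
  have Cs: "Cinfinite (cardSuc k)" using Cinfinite_cardSuc[OF Ck] .
  have smaller: "Col U E (cardSuc k)" if "U \<subseteq> V" "|U| <o |V|" for U
    by (rule less.IH[OF that(2) SList_subset[OF k less.prems that(1)]])
  show ?case
  proof (cases "|V| \<le>o cardSuc k")
    case True
    then show ?thesis using Cs by (intro Col_small) simp_all
  next
    case False
    then have big: "cardSuc k <o |V|" using not_ordLeq_card_iff(1)[of "cardSuc k" V] Cs by blast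
    show ?thesis
    proof (cases "regularCard |V|")
      case True
      have "Cinfinite |V|" using cinfinite_mono[OF ordLess_imp_ordLeq[OF big]] Cs by simp
      then have m: "regular_cardinal |V|" using True unfolding regular_cardinal_def by blast
      show ?thesis
        using Col_regular[OF gch k _ m big ap[OF m], of E] less.prems smaller by simp
    next
      case False
      have "k <o |V|"
        using Ck by (intro ordLess_transitive[OF cardSuc_greater big]) simp
      then show ?thesis by (rule Col_singular[OF Ck _ False smaller])
    qed
  qed
qed

theorem theorem2p5:
  fixes \<kappa> :: "'u rel" and V :: "'u set" and E :: "'u set set"
  assumes "GCH TYPE('u)"
    and "regular_cardinal \<kappa>"
    and "graph V E"
    and "SList V E \<kappa>"
  shows "Col V E (cardSuc (cardSuc \<kappa>)) \<and>
    ((\<forall>\<mu> :: 'u rel. regular_cardinal \<mu> \<longrightarrow> Field \<mu> \<in> I[\<mu>]) \<longrightarrow> Col V E (cardSuc \<kappa>))"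
  using Col_cardSuc_cardSuc[OF assms(1,2,4)] Col_cardSuc[OF assms(1,2) _ assms(4)] by blast

end
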